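(* Let $\Phi=B_n$ or $D_n$, let $D\subset\Phi^+$ be an orthogonal rook placement, let $\xi=(\xi_\beta)_{\beta\in D}$ be a tuple of non-zero scalars from $\mathbb{F}_q$, and let $\Omega=\Omega_{D,\xi}\subset\mathfrak{u}^*$ be the associated coadjoint orbit. Then $\dim\Omega$ equals the total number of pluses and minuses in the diagram $(\Phi,\mathcal{F}_D)$, i.e. $$\dim\Omega=\#\{\alpha\in\Phi^+\mid\mathcal{F}_D(\alpha)\in\{+,-\}\}.$$
   Context: Root systems. Let $\epsilon_1,\dots,\epsilon_n$ be the standard basis of $\mathbb{R}^n$. $B_n=\{\pm\epsilon_i\pm\epsilon_j,\ i<j\}\cup\{\pm\epsilon_i\}$, $D_n=\{\pm\epsilon_i\pm\epsilon_j,\ i<j\}$; the positive roots are $B_n^+=\{\epsilon_i\pm\epsilon_j,\ 1\le i<j\le n\}\cup\{\epsilon_i,\ 1\le i\le n\}$ and $D_n^+=\{\epsilon_i\pm\epsilon_j,\ 1\le i<j\le n\}$. For positive roots put $\mathrm{col}(\epsilon_i\pm\epsilon_j)=\mathrm{col}(\epsilon_i)=i$, $\mathrm{row}(\epsilon_i\pm\epsilon_j)=\mp j$ (for $i<j$), $\mathrm{row}(\epsilon_i)=0$. Let $R_i=\{\alpha\in\Phi^+\mid\mathrm{row}(\alpha)=i\}$ for $-n+1\le i\le n-1$ and $C_j=\{\alpha\in\Phi^+\mid\mathrm{col}(\alpha)=j\}$ for $1\le j\le n$. Lie algebra and group. Let $m=2n+1$ for $\Phi=B_n$ and $m=2n$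 for $\Phi=D_n$; $\mathbb{F}_q$ is a finite field of characteristic $p\ge m$. Rows and columns of $m\times m$ matrices are indexed by $1,2,\dots,n,0,-n,\dots,-2,-1$ in this order (no index $0$ for $D_n$), and $e_{a,b}$ are the elementary matrices. Put $e_{\epsilon_i}=e_{0,i}-e_{-i,0}$, $e_{\epsilon_i-\epsilon_j}=e_{j,i}-e_{-i,-j}$, $e_{\epsilon_i+\epsilon_j}=e_{-j,i}-e_{-i,j}$ ($i<j$). Then $\mathfrak{u}=\mathfrak{u}(\Phi)\subset\mathfrak{gl}_m(\mathbb{F}_q)$ is the Lie subalgebra with basis $e_\alpha$, $\alpha\in\Phi^+$; $e_\alpha^*$ denotes the dual basis of $\mathfrak{u}^*$. $U=\exp(\mathfrak{u})$ where $\exp(x)=\sum_{i=0}^{m-1}x^i/i!$. The group $U$ acts on $\mathfrak{u}$ by conjugation and on $\mathfrak{u}^*$ by the dual (coadjoint) action $(g.\lambda)(x)=\lambda(g^{-1}xg)$. For a coadjoint orbit $\Omega$, $\dim\Omega$ is the number with $q^{\dim\Omega}=|\Omega|$. Orthogonal rook placement: a subset $D\subset\Phi^+$ of pairwise orthogonal roots with $|D\cap R_i|\le1$ and $|D\cap C_j|\le1$ for all $i,j$. Write $D=\{\beta_1,\dots,\beta_t\}$ with $\mathrm{col}(\beta_1)<\dots<\mathrm{col}(\beta_t)$. The associated orbit $\Omega_{D,\xi}$ is the coadjoint orbit of $f_{D,\xi}=\sum_{\beta\in D}\xi_\beta e_\beta^*$. Singular roots. For $\beta\in\Phi^+$, $S(\beta)$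 is the set of all $\alpha\in\Phi^+$ for which there is $\gamma\in\Phi^+$ with $\alpha+\gamma=\beta$; $S^+(\beta)=\{\alpha\in S(\beta)\mid\mathrm{col}(\alpha)=\mathrm{col}(\beta)\}$, $S^-(\beta)=S(\beta)\setminus S^+(\beta)$. (In each pair $\alpha+\gamma=\beta$ exactly one root lies in $S^+(\beta)$.) Battleship. The map $\mathcal{F}_D\colon\Phi^+\to\{\otimes,\bullet,+,-\}$ is defined in steps. Step $0$: $\mathcal{F}_D(\beta)=\otimes$ for $\beta\in D$. Step $i$, for $i=1,\dots,t$: for all $\gamma\in S^+(\beta_i)$, $\delta\in S^-(\beta_i)$ with $\gamma+\delta=\beta_i$ such that neither $\gamma$ nor $\delta$ was mapped to $-$ at any of the steps $0,\dots,i-1$, put $\mathcal{F}_D(\gamma)=+$ and $\mathcal{F}_D(\delta)=-$. Finally $\mathcal{F}_D(\alpha)=\bullet$ for all remaining roots. The pair $(\Phi,\mathcal{F}_D)$ is called the diagram associated with $D$. *)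

theory Defs
  imports
    "Jordan_Normal_Form.Matrix"
    "Jordan_Normal_Form.Gauss_Jordan_Elimination"
    "HOL-Computational_Algebra.Computational_Algebra"
    "HOL-Library.Cardinality"
    "HOL-Library.FuncSet"
begin

section \<open>Positive roots of type $B_n$ and $D_n$\<close>

datatype root_type = Type_B | Type_D

text \<open>
  The positive roots are named by a datatype: \<open>Short i\<close> is $\epsilon_i$, \<open>Diff i j\<close> is
  $\epsilon_i - \epsilon_j$ and \<open>Add i j\<close> is $\epsilon_i + \epsilon_j$. The vector in
  $\mathbb{R}^n$ which a name denotes is \<open>root_vec\<close>; it is injective on \<open>pos_roots\<close>
  (lemma \<open>inj_on_root_vec\<close>), and sums and orthogonality of roots always refer to these vectors.
\<close>

datatype root = Short nat | Diff nat nat | Add nat nat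

definition pos_roots :: "root_type \<Rightarrow> nat \<Rightarrow> root set" where
  "pos_roots \<Phi> n =
     {Diff i j | i j. 1 \<le> i \<and> i < j \<and> j \<le> n} \<union>
     {Add i j | i j. 1 \<le> i \<and> i < j \<and> j \<le> n} \<union>
     (case \<Phi> of Type_B \<Rightarrow> {Short i | i. 1 \<le> i \<and> i \<le> n} | Type_D \<Rightarrow> {})"

text \<open>The standard basis is numbered from 1, whereas \<^const>\<open>unit_vec\<close> counts from 0.\<close>

definition eps :: "nat \<Rightarrow> nat \<Rightarrow> real vec" where
  "eps n i = unit_vec n (i - 1)"

fun root_vec :: "nat \<Rightarrow> root \<Rightarrow> real vec" where
  "root_vec n (Short i) = eps n i"
| "root_vec n (Diff i j) = eps n i - eps n j"
| "root_vec n (Add i j) = eps n i + eps n j"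

fun root_col :: "root \<Rightarrow> nat" where
  "root_col (Short i) = i"
| "root_col (Diff i j) = i"
| "root_col (Add i j) = i"

fun root_row :: "root \<Rightarrow> int" where
  "root_row (Short i) = 0"
| "root_row (Diff i j) = int j"
| "root_row (Add i j) = - int j"

lemma inj_on_root_vec: "inj_on (root_vec n) (pos_roots \<Phi> n)"
proof (rule inj_onI)
  fix \<alpha> \<beta>
  assume roots: "\<alpha> \<in> pos_roots \<Phi> n" "\<beta> \<in> pos_roots \<Phi> n"
    and eq: "root_vec n \<alpha> = root_vec n \<beta>"
  have eps: "eps n i $ (k - Suc 0) = (if k = i then 1 else 0)"
    if "1 \<le> i" "i \<le> n" "1 \<le> k" "k \<le> n" for i k
    using that by (auto simp: eps_def)
  have dim: "dim_vec (eps n i) = n" for i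
    by (simp add: eps_def)
  have at: "1 \<le> k \<Longrightarrow> k \<le> n \<Longrightarrow> root_vec n \<alpha> $ (k - Suc 0) = root_vec n \<beta> $ (k - Suc 0)" for k
    using eq by simp
  show "\<alpha> = \<beta>"
    using roots at[of "root_col \<alpha>"] at[of "root_col \<beta>"]
      at[of "nat \<bar>root_row \<alpha>\<bar>"] at[of "nat \<bar>root_row \<beta>\<bar>"]
    by (cases \<alpha>; cases \<beta>)
       (auto simp: pos_roots_def eps dim split: root_type.splits if_splits)
qed

definition roots_in_row :: "root_type \<Rightarrow> nat \<Rightarrow> int \<Rightarrow> root set" where
  "roots_in_row \<Phi> n i = {\<alpha> \<in> pos_roots \<Phi> n. root_row \<alpha> = i}"

definition roots_in_col :: "root_type \<Rightarrow> nat \<Rightarrow> nat \<Rightarrow> root set" where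
  "roots_in_col \<Phi> n j = {\<alpha> \<in> pos_roots \<Phi> n. root_col \<alpha> = j}"

text \<open>
  The row condition is a real restriction only for row 0: two distinct roots in the same nonzero
  row have inner product 1.
\<close>

definition orthogonal_rook_placement :: "root_type \<Rightarrow> nat \<Rightarrow> root set \<Rightarrow> bool" where
  "orthogonal_rook_placement \<Phi> n D \<longleftrightarrow>
     D \<subseteq> pos_roots \<Phi> n \<and>
     pairwise (\<lambda>\<alpha> \<beta>. root_vec n \<alpha> \<bullet> root_vec n \<beta> = 0) D \<and>
     (\<forall>i. card (D \<inter> roots_in_row \<Phi> n i) \<le> 1) \<and>
     (\<forall>j. card (D \<inter> roots_in_col \<Phi> n j) \<le> 1)"


section \<open>The Lie algebra and its dual\<close>

definition mat_size :: "root_type \<Rightarrow> nat \<Rightarrow> nat" where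
  "mat_size \<Phi> n = (case \<Phi> of Type_B \<Rightarrow> 2 * n + 1 | Type_D \<Rightarrow> 2 * n)"

text \<open>
  The position, counted from 0, of the index \<open>a\<close> in the list $1, 2, \dots, n, 0, -n, \dots, -1$
  (where 0 is missing for $D_n$).
\<close>

definition pos_of :: "root_type \<Rightarrow> nat \<Rightarrow> int \<Rightarrow> nat" where
  "pos_of \<Phi> n a =
     (if a > 0 then nat a - 1 else if a = 0 then n else nat (int (mat_size \<Phi> n) + a))"

definition elem_mat :: "root_type \<Rightarrow> nat \<Rightarrow> int \<Rightarrow> int \<Rightarrow> 'a::field mat" where
  "elem_mat \<Phi> n a b = mat (mat_size \<Phi> n) (mat_size \<Phi> n)
     (\<lambda>(r, s). if r = pos_of \<Phi> n a \<and> s = pos_of \<Phi> n b then 1 else 0)"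

fun root_mat :: "root_type \<Rightarrow> nat \<Rightarrow> root \<Rightarrow> 'a::field mat" where
  "root_mat \<Phi> n (Short i) = elem_mat \<Phi> n 0 (int i) - elem_mat \<Phi> n (- int i) 0"
| "root_mat \<Phi> n (Diff i j) =
     elem_mat \<Phi> n (int j) (int i) - elem_mat \<Phi> n (- int i) (- int j)"
| "root_mat \<Phi> n (Add i j) =
     elem_mat \<Phi> n (- int j) (int i) - elem_mat \<Phi> n (- int i) (int j)"

text \<open>The linear combination $\sum_\alpha c_\alpha e_\alpha$, written entrywise.\<close>

definition root_comb :: "root_type \<Rightarrow> nat \<Rightarrow> (root \<Rightarrow> 'a) \<Rightarrow> 'a::field mat" where
  "root_comb \<Phi> n c = mat (mat_size \<Phi> n) (mat_size \<Phi> n)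
     (\<lambda>rs. \<Sum>\<alpha>\<in>pos_roots \<Phi> n. c \<alpha> * root_mat \<Phi> n \<alpha> $$ rs)"

definition lie_u :: "root_type \<Rightarrow> nat \<Rightarrow> 'a::field mat set" where
  "lie_u \<Phi> n = range (root_comb \<Phi> n)"

text \<open>
  Functionals on $\mathfrak{u}$ are extensional functions on matrices, so that they are equal
  as soon as they agree on $\mathfrak{u}$.
\<close>

definition dual_u :: "root_type \<Rightarrow> nat \<Rightarrow> ('a::field mat \<Rightarrow> 'a) set" where
  "dual_u \<Phi> n = {f \<in> extensional (lie_u \<Phi> n).
     (\<forall>x\<in>lie_u \<Phi> n. \<forall>y\<in>lie_u \<Phi> n. f (x + y) = f x + f y) \<and>
     (\<forall>c. \<forall>x\<in>lie_u \<Phi> n. f (c \<cdot>\<^sub>m x) = c * f x)}"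

definition dual_basis :: "root_type \<Rightarrow> nat \<Rightarrow> root \<Rightarrow> 'a::field mat \<Rightarrow> 'a" where
  "dual_basis \<Phi> n \<alpha> = (THE f. f \<in> dual_u \<Phi> n \<and>
     (\<forall>\<gamma>\<in>pos_roots \<Phi> n. f (root_mat \<Phi> n \<gamma>) = (if \<gamma> = \<alpha> then 1 else 0)))"


section \<open>The group and coadjoint orbits\<close>

text \<open>The exponential of an $m \times m$ matrix, truncated after the term of degree $m - 1$.\<close>

definition trunc_exp :: "nat \<Rightarrow> 'a::field mat \<Rightarrow> 'a mat" where
  "trunc_exp m x = mat m m (\<lambda>rs. \<Sum>i<m. (x ^\<^sub>m i) $$ rs / of_nat (fact i))"

definition group_U :: "root_type \<Rightarrow> nat \<Rightarrow> 'a::field mat set" where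
  "group_U \<Phi> n = trunc_exp (mat_size \<Phi> n) ` lie_u \<Phi> n"

definition coadjoint ::
  "root_type \<Rightarrow> nat \<Rightarrow> 'a::field mat \<Rightarrow> ('a mat \<Rightarrow> 'a) \<Rightarrow> 'a mat \<Rightarrow> 'a" where
  "coadjoint \<Phi> n g f = (\<lambda>x\<in>lie_u \<Phi> n. f (the (mat_inverse g) * x * g))"

definition coadjoint_orbit ::
  "root_type \<Rightarrow> nat \<Rightarrow> ('a::field mat \<Rightarrow> 'a) \<Rightarrow> ('a mat \<Rightarrow> 'a) set" where
  "coadjoint_orbit \<Phi> n f = (\<lambda>g. coadjoint \<Phi> n g f) ` group_U \<Phi> n"

definition rook_form ::
  "root_type \<Rightarrow> nat \<Rightarrow> root set \<Rightarrow> (root \<Rightarrow> 'a) \<Rightarrow> 'a::field mat \<Rightarrow> 'a" where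
  "rook_form \<Phi> n D \<xi> = (\<lambda>x\<in>lie_u \<Phi> n. \<Sum>\<beta>\<in>D. \<xi> \<beta> * dual_basis \<Phi> n \<beta> x)"

definition rook_orbit ::
  "root_type \<Rightarrow> nat \<Rightarrow> root set \<Rightarrow> (root \<Rightarrow> 'a) \<Rightarrow> ('a::field mat \<Rightarrow> 'a) set" where
  "rook_orbit \<Phi> n D \<xi> = coadjoint_orbit \<Phi> n (rook_form \<Phi> n D \<xi>)"

definition orbit_dim :: "('a::{field,finite} mat \<Rightarrow> 'a) set \<Rightarrow> nat" where
  "orbit_dim \<Omega> = (THE d. CARD('a) ^ d = card \<Omega>)"


section \<open>Singular roots and the diagram of a rook placement\<close>

definition singular :: "root_type \<Rightarrow> nat \<Rightarrow> root \<Rightarrow> root set" where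
  "singular \<Phi> n \<beta> = {\<alpha> \<in> pos_roots \<Phi> n.
     \<exists>\<gamma>\<in>pos_roots \<Phi> n. root_vec n \<alpha> + root_vec n \<gamma> = root_vec n \<beta>}"

definition singular_plus :: "root_type \<Rightarrow> nat \<Rightarrow> root \<Rightarrow> root set" where
  "singular_plus \<Phi> n \<beta> = {\<alpha> \<in> singular \<Phi> n \<beta>. root_col \<alpha> = root_col \<beta>}"

definition singular_minus :: "root_type \<Rightarrow> nat \<Rightarrow> root \<Rightarrow> root set" where
  "singular_minus \<Phi> n \<beta> = singular \<Phi> n \<beta> - singular_plus \<Phi> n \<beta>"

datatype mark = Rook_mark | Bullet_mark | Plus_mark | Minus_mark

text \<open>
  The pairs $(\gamma, \delta)$ treated in the step for \<open>\<beta>\<close>, if \<open>F\<close> is the marking before this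
  step. A root that was once mapped to \<open>Minus_mark\<close> is never treated again and thus keeps this
  mark, so only the current marking has to be inspected instead of the whole history.
\<close>

definition admissible_pairs ::
  "root_type \<Rightarrow> nat \<Rightarrow> root \<Rightarrow> (root \<Rightarrow> mark) \<Rightarrow> (root \<times> root) set" where
  "admissible_pairs \<Phi> n \<beta> F = {(\<gamma>, \<delta>).
     \<gamma> \<in> singular_plus \<Phi> n \<beta> \<and> \<delta> \<in> singular_minus \<Phi> n \<beta> \<and>
     root_vec n \<gamma> + root_vec n \<delta> = root_vec n \<beta> \<and>
     F \<gamma> \<noteq> Minus_mark \<and> F \<delta> \<noteq> Minus_mark}"

definition battleship_step ::
  "root_type \<Rightarrow> nat \<Rightarrow> root \<Rightarrow> (root \<Rightarrow> mark) \<Rightarrow> root \<Rightarrow> mark" where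
  "battleship_step \<Phi> n \<beta> F = (\<lambda>\<alpha>.
     if \<alpha> \<in> fst ` admissible_pairs \<Phi> n \<beta> F then Plus_mark
     else if \<alpha> \<in> snd ` admissible_pairs \<Phi> n \<beta> F then Minus_mark
     else F \<alpha>)"

text \<open>
  \<open>Bullet_mark\<close> is the initial mark outside \<open>D\<close>, hence the final mark of all roots never treated.
  Roots of a rook placement are in distinct columns, so sorting by \<^const>\<open>root_col\<close> is unambiguous.
\<close>

definition battleship :: "root_type \<Rightarrow> nat \<Rightarrow> root set \<Rightarrow> root \<Rightarrow> mark" where
  "battleship \<Phi> n D = fold (battleship_step \<Phi> n) (sorted_key_list_of_set root_col D)
     (\<lambda>\<alpha>. if \<alpha> \<in> D then Rook_mark else Bullet_mark)"

end

theory Submission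
  imports Defs
begin

text \<open>
  Let \<open>*\<close> be the transposition along the antidiagonal. Then $\mathfrak{u}$ consists of the strictly
  lower triangular $x$ with $x^* = -x$, and $U$ is the group $G$ of all lower unitriangular $g$ with
  $g^* g = 1$: the exponential maps $\mathfrak{u}$ injectively into $G$, and the Cayley transform
  $x \mapsto (1 + x)(1 - x)^{-1}$ is a bijection from $\mathfrak{u}$ onto $G$, so the two sets
  have the same number of elements. The Cayley transform also linearises stabilisers. If $g$ is the
  transform of $x$ and $y = (1 + x) z (1 - x)$, then $y - g^{-1} y g = 2 (x z - z x)$; hence
  $g$ fixes $f$ if and only if $x$ lies in the radical of the form $(x, z) \mapsto f([x, z])$, and
  $|\Omega|$ is $|\mathfrak{u}|$ divided by the size of this radical.

  For $f = f_{D,\xi}$ the matrix of the form in the basis $e_\alpha$ has a nonzero entry at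
  $(\alpha, \gamma)$ exactly if $\alpha + \gamma \in D$. The battleship steps are an elimination:
  when a pair $\gamma + \delta = \beta$ is marked, $\delta$ is the only unmarked root whose sum with
  $\gamma$ lies in $D$, so deleting $\gamma$ and $\delta$ preserves the size of the kernel. After
  the last step the matrix vanishes on the unmarked roots.
\<close>

section \<open>The incidence algebra of the integers\<close>

text \<open>Stabilisers count an orbit only once U is known to be a group. Closure of exp(u) under
  products would usually come from the Baker-Campbell-Hausdorff formula; over a finite field the
  comparison of cardinalities with G replaces it. From then on the exponential is not mentioned
  again and the Cayley transform takes over: it is rational in x, so that clearing the denominator 1
  - x leaves a condition linear in x.

  The bound p >= m enters through the factorials i! with i < m, which must be invertible. For m >= 3
  they include 2! = 2, by which the Cayley argument divides. For m < 3 the characteristic may be 2,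
  but then there are no positive roots and the orbit is a point.

  On the combinatorial side everything rests on columns: if two positive roots add up to \<beta>,
  one lies in the column of \<beta> and the other in a strictly later one. Treating D by increasing
  columns therefore guarantees that whatever could interfere with a step has been dealt with before
  it.\<close>

text \<open>
  Lower triangular matrices with rows and columns indexed by all integers form a ring whose type does
  not depend on a size, and the transposition along an antidiagonal is an anti-automorphism of it.
\<close>

typedef (overloaded) 'a inc = "{f :: int \<Rightarrow> int \<Rightarrow> 'a::zero. \<forall>r s. r < s \<longrightarrow> f r s = 0}"
  morphisms entry Inc
  by (rule exI[of _ "\<lambda>_ _. 0"]) simp

setup_lifting type_definition_inc

lemma entry_upper [simp]: "r < s \<Longrightarrow> entry x r s = 0"
  using entry[of x] by simp

lemma inc_eqI: "(\<And>r s. s \<le> r \<Longrightarrow> entry x r s = entry y r s) \<Longrightarrow> x = y"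
  by (metis entry_inject entry_upper ext linorder_not_le)

lemma sum_shrink_left:
  fixes f :: "int \<Rightarrow> 'a::comm_monoid_add"
  assumes "s \<le> k" "\<And>l. s \<le> l \<Longrightarrow> l < k \<Longrightarrow> f l = 0"
  shows "(\<Sum>l\<in>{k..r}. f l) = (\<Sum>l\<in>{s..r}. f l)"
  using assms by (intro sum.mono_neutral_left) auto

lemma sum_shrink_right:
  fixes f :: "int \<Rightarrow> 'a::comm_monoid_add"
  assumes "k \<le> r" "\<And>l. k < l \<Longrightarrow> l \<le> r \<Longrightarrow> f l = 0"
  shows "(\<Sum>l\<in>{s..k}. f l) = (\<Sum>l\<in>{s..r}. f l)"
  using assms by (intro sum.mono_neutral_left) auto

text \<open>Only indices between the column and the row contribute to an entry of a product, so
  products are finite sums although the index set is infinite.\<close>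

instantiation inc :: (ring_1) ring_1
begin

lift_definition zero_inc :: "'a inc" is "\<lambda>_ _. 0" by simp
lift_definition one_inc :: "'a inc" is "\<lambda>r s. if r = s then 1 else 0" by simp
lift_definition plus_inc :: "'a inc \<Rightarrow> 'a inc \<Rightarrow> 'a inc" is "\<lambda>x y r s. x r s + y r s" by simp
lift_definition minus_inc :: "'a inc \<Rightarrow> 'a inc \<Rightarrow> 'a inc" is "\<lambda>x y r s. x r s - y r s" by simp
lift_definition uminus_inc :: "'a inc \<Rightarrow> 'a inc" is "\<lambda>x r s. - x r s" by simp
lift_definition times_inc :: "'a inc \<Rightarrow> 'a inc \<Rightarrow> 'a inc"
  is "\<lambda>x y r s. \<Sum>k\<in>{s..r}. x r k * y k s" by simp

instance
proof
  fix a b c :: "'a inc"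
  show "a + b + c = a + (b + c)" by transfer (simp add: add.assoc)
  show "a + b = b + a" by transfer (simp add: add.commute)
  show "0 + a = a" by transfer simp
  show "- a + a = 0" by transfer simp
  show "a - b = a + - b" by transfer simp
  show "(0::'a inc) \<noteq> 1"
    by transfer (metis zero_neq_one)
  show "(a + b) * c = a * c + b * c"
    by transfer (simp add: distrib_right sum.distrib)
  show "a * (b + c) = a * b + a * c"
    by transfer (simp add: distrib_left sum.distrib)
  show "a * b * c = a * (b * c)"
  proof (transfer, intro ext)
    fix a b c :: "int \<Rightarrow> int \<Rightarrow> 'a" and r s :: int
    assume z: "\<forall>r s. r < s \<longrightarrow> a r s = 0" "\<forall>r s. r < s \<longrightarrow> b r s = 0" "\<forall>r s. r < s \<longrightarrow> c r s = 0"
    \<comment> \<open>Zero terms extend both inner sums to the whole interval from s to r, so that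
      the order of summation can be exchanged.\<close>
    have "(\<Sum>k\<in>{s..r}. (\<Sum>l\<in>{k..r}. a r l * b l k) * c k s)
        = (\<Sum>k\<in>{s..r}. \<Sum>l\<in>{s..r}. a r l * b l k * c k s)"
      by (intro sum.cong refl, subst sum_shrink_left[of s])
         (auto simp: z sum_distrib_right)
    also have "\<dots> = (\<Sum>l\<in>{s..r}. \<Sum>k\<in>{s..r}. a r l * b l k * c k s)"
      by (rule sum.swap)
    also have "\<dots> = (\<Sum>l\<in>{s..r}. a r l * (\<Sum>k\<in>{s..l}. b l k * c k s))"
      by (intro sum.cong refl, subst sum_shrink_right[of _ r])
         (auto simp: z sum_distrib_left mult.assoc)
    finally show "(\<Sum>k\<in>{s..r}. (\<Sum>l\<in>{k..r}. a r l * b l k) * c k s)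
        = (\<Sum>l\<in>{s..r}. a r l * (\<Sum>k\<in>{s..l}. b l k * c k s))" .
  qed
  show "1 * a = a"
  proof (transfer, intro ext)
    fix a :: "int \<Rightarrow> int \<Rightarrow> 'a" and r s :: int
    assume z: "\<forall>r s. r < s \<longrightarrow> a r s = 0"
    have "(\<Sum>k\<in>{s..r}. (if r = k then 1 else 0) * a k s) = (\<Sum>k\<in>{s..r}. if r = k then a k s else 0)"
      by (intro sum.cong) auto
    also have "\<dots> = a r s" using z by auto
    finally show "(\<Sum>k\<in>{s..r}. (if r = k then 1 else 0) * a k s) = a r s" .
  qed
  show "a * 1 = a"
  proof (transfer, intro ext)
    fix a :: "int \<Rightarrow> int \<Rightarrow> 'a" and r s :: int
    assume z: "\<forall>r s. r < s \<longrightarrow> a r s = 0"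
    have "(\<Sum>k\<in>{s..r}. a r k * (if k = s then 1 else 0)) = (\<Sum>k\<in>{s..r}. if k = s then a r k else 0)"
      by (intro sum.cong) auto
    also have "\<dots> = a r s" using z by auto
    finally show "(\<Sum>k\<in>{s..r}. a r k * (if k = s then 1 else 0)) = a r s" .
  qed
qed

end

lemma entry_simps [simp]:
  "entry 0 r s = 0" "entry 1 r s = (if r = s then 1 else 0)"
  "entry (x + y) r s = entry x r s + entry y r s"
  "entry (x - y) r s = entry x r s - entry y r s"
  "entry (- x) r s = - entry x r s"
  by (transfer, simp)+

lemma entry_mult: "entry (x * y) r s = (\<Sum>k\<in>{s..r}. entry x r k * entry y k s)"
  by transfer simp

lemma entry_sum [simp]: "entry (sum f A) r s = (\<Sum>a\<in>A. entry (f a) r s)"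
  by (induction A rule: infinite_finite_induct) auto

text \<open>Scalars enter as diagonal elements, so that linear combinations are expressed by ring
  operations alone.\<close>

lift_definition scal :: "'a::ring_1 \<Rightarrow> 'a inc" is "\<lambda>c r s. if r = s then c else 0" by simp

lemma entry_scal [simp]: "entry (scal c) r s = (if r = s then c else 0)"
  by transfer simp

lemma entry_scal_mult [simp]: "entry (scal c * x) r s = c * entry x r s"
proof -
  have "entry (scal c * x) r s = (\<Sum>k\<in>{s..r}. if r = k then c * entry x k s else 0)"
    unfolding entry_mult by (intro sum.cong) auto
  also have "\<dots> = c * entry x r s" by auto
  finally show ?thesis .
qed

lemma scal_commute: "x * scal c = scal c * (x :: 'a::comm_ring_1 inc)"
proof (rule inc_eqI)
  fix r s :: int assume "s \<le> r"
  have "entry (x * scal c) r s = (\<Sum>k\<in>{s..r}. if k = s then entry x r k * c else 0)"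
    unfolding entry_mult by (intro sum.cong) auto
  also have "\<dots> = entry (scal c * x) r s" using \<open>s \<le> r\<close> by (simp add: mult.commute)
  finally show "entry (x * scal c) r s = entry (scal c * x) r s" .
qed

lemma scal_hom: "scal 0 = 0" "scal 1 = 1" "scal (a * b) = scal a * scal b"
  "scal (a + b) = scal a + scal b" "scal (- a) = - scal a"
  by (rule inc_eqI; simp)+

lemma scal_mult_mult:
  "(scal a * x) * (scal b * y) = scal (a * b) * (x * (y :: 'a::comm_ring_1 inc))"
  by (metis mult.assoc scal_commute scal_hom(3))

lemma scal_left_commute: "x * (scal c * y) = scal c * (x * (y :: 'a::comm_ring_1 inc))"
  by (metis mult.assoc scal_commute)

text \<open>The antidiagonal is r + s = c. The value c = m - 1 reflects the block with indices 0,
  ..., m - 1 onto itself.\<close>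

lift_definition star :: "int \<Rightarrow> 'a::zero inc \<Rightarrow> 'a inc" is "\<lambda>c x r s. x (c - s) (c - r)" by simp

lemma entry_star [simp]: "entry (star c x) r s = entry x (c - s) (c - r)"
  by transfer simp

lemma star_simps [simp]:
  "star c 0 = 0" "star c 1 = 1" "star c (x + y) = star c x + star c y"
  "star c (x - y) = star c x - star c y" "star c (- x) = - star c x" "star c (scal a) = scal a"
  "star c (star c x) = x"
  by (rule inc_eqI; simp)+

lemma star_mult [simp]:
  "star c (x * y) = star c y * star c (x :: 'a::comm_ring_1 inc)"
proof (rule inc_eqI)
  fix r s :: int
  have "(\<Sum>k\<in>{c - r..c - s}. entry x (c - s) k * entry y k (c - r))
      = (\<Sum>k\<in>{s..r}. entry x (c - s) (c - k) * entry y (c - k) (c - r))"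
    by (rule sum.reindex_bij_witness[of _ "\<lambda>k. c - k" "\<lambda>k. c - k"]) auto
  then show "entry (star c (x * y)) r s = entry (star c y * star c x) r s"
    by (simp add: entry_mult mult.commute)
qed

lemma star_power [simp]: "star c (x ^ k) = star c (x :: 'a::comm_ring_1 inc) ^ k"
  by (induction k) (simp_all add: power_commutes)

lemma star_sum [simp]: "star c (sum f A) = (\<Sum>a\<in>A. star c (f a :: 'a::ring_1 inc))"
  by (induction A rule: infinite_finite_induct) auto

section \<open>The filtration by subdiagonals and nilpotency\<close>

definition level :: "nat \<Rightarrow> 'a::zero inc \<Rightarrow> bool" where
  "level l x \<longleftrightarrow> (\<forall>r s. r < s + int l \<longrightarrow> entry x r s = 0)"

definition in_block :: "int \<Rightarrow> 'a::zero inc \<Rightarrow> bool" where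
  "in_block m x \<longleftrightarrow> (\<forall>r s. s < 0 \<or> m \<le> r \<longrightarrow> entry x r s = 0)"

lemma level_closed:
  fixes x y :: "'a::ring_1 inc"
  shows "level l 0" "level l x \<Longrightarrow> level l y \<Longrightarrow> level l (x + y)" "level l x \<Longrightarrow> level l y \<Longrightarrow> level l (x - y)"
    "level l x \<Longrightarrow> level l (- x)" "level l x \<Longrightarrow> level l (scal c * x)"
  by (auto simp: level_def)

lemma level_sum: "(\<And>a. a \<in> A \<Longrightarrow> level l (f a)) \<Longrightarrow> level l (sum f A :: 'a::ring_1 inc)"
  by (auto simp: level_def)

lemma level_mult:
  fixes x y :: "'a::ring_1 inc"
  assumes "level k x" "level l y" shows "level (k + l) (x * y)"
  unfolding level_def entry_mult
proof (intro allI impI sum.neutral ballI)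
  fix r s i assume "r < s + int (k + l)"
  then have "r < i + int k \<or> i < s + int l" by linarith
  then show "entry x r i * entry y i s = 0" using assms by (auto simp: level_def)
qed

lemma level_mono: "level l x \<Longrightarrow> k \<le> l \<Longrightarrow> level k x"
  by (auto simp: level_def)

lemma in_block_closed:
  fixes x y :: "'a::ring_1 inc"
  shows "in_block m 0" "in_block m x \<Longrightarrow> in_block m y \<Longrightarrow> in_block m (x + y)"
    "in_block m x \<Longrightarrow> in_block m y \<Longrightarrow> in_block m (x - y)"
    "in_block m x \<Longrightarrow> in_block m (- x)" "in_block m x \<Longrightarrow> in_block m (scal c * x)"
  by (simp_all add: in_block_def)

lemma in_block_mult:
  fixes x y :: "'a::ring_1 inc"
  assumes "in_block m x" "in_block m y" shows "in_block m (x * y)"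
  unfolding in_block_def entry_mult
proof (intro allI impI sum.neutral ballI)
  fix r s k :: int assume "s < 0 \<or> m \<le> r"
  then show "entry x r k * entry y k s = 0" using assms by (auto simp: in_block_def)
qed

text \<open>The unit of the ring is the identity on all integers and lies in no block. Unitriangular
  elements of size m are therefore described by \<open>g - 1 \<in> strict m\<close>.\<close>

definition strict :: "nat \<Rightarrow> 'a::zero inc set" where
  "strict m = {x. level 1 x \<and> in_block (int m) x}"

lemma strict_closed [intro]:
  fixes x y :: "'a::ring_1 inc"
  shows "0 \<in> strict m" "x \<in> strict m \<Longrightarrow> y \<in> strict m \<Longrightarrow> x + y \<in> strict m"
    "x \<in> strict m \<Longrightarrow> y \<in> strict m \<Longrightarrow> x - y \<in> strict m"
    "x \<in> strict m \<Longrightarrow> - x \<in> strict m" "x \<in> strict m \<Longrightarrow> scal c * x \<in> strict m"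
    "x \<in> strict m \<Longrightarrow> y \<in> strict m \<Longrightarrow> x * y \<in> strict m"
  using level_mono[OF level_mult, of 1 x 1 y 1]
  by (simp_all add: strict_def level_closed in_block_closed in_block_mult)

lemma strict_sum [intro]:
  "(\<And>a. a \<in> A \<Longrightarrow> f a \<in> strict m) \<Longrightarrow> (sum f A :: 'a::ring_1 inc) \<in> strict m"
  by (induction A rule: infinite_finite_induct) auto

lemma strict_power: "x \<in> strict m \<Longrightarrow> 0 < k \<Longrightarrow> (x :: 'a::ring_1 inc) ^ k \<in> strict m"
proof (induction k)
  case (Suc k) then show ?case by (cases k) auto
qed simp

lemma star_strict [intro]: "x \<in> strict m \<Longrightarrow> star (int m - 1) (x :: 'a::zero inc) \<in> strict m"
  by (auto simp: strict_def level_def in_block_def)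

lemma level_power: "level 1 x \<Longrightarrow> level k ((x :: 'a::ring_1 inc) ^ k)"
proof (induction k)
  case (Suc k) then show ?case using level_mult[of 1 x k "x ^ k"] by simp
qed (simp add: level_def)

text \<open>Within the block r - s is at most m - 1, so nothing survives from the m-th subdiagonal
  on.\<close>

lemma strict_level_zero: "x \<in> strict m \<Longrightarrow> level l x \<Longrightarrow> m \<le> l \<Longrightarrow> x = (0 :: 'a::ring_1 inc)"
proof (rule inc_eqI)
  fix r s assume *: "x \<in> strict m" "level l x" "m \<le> l"
  show "entry x r s = entry 0 r s"
  proof (cases "s < 0 \<or> int m \<le> r")
    case True then show ?thesis using * by (auto simp: strict_def in_block_def)
  next
    case False
    then have "r < s + int l" using * by linarith
    then show ?thesis using * by (auto simp: level_def)
  qed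
qed

lemma strict_nilpotent:
  assumes "x \<in> strict m" "m \<le> k" "0 < k" shows "(x :: 'a::ring_1 inc) ^ k = 0"
  using strict_level_zero[OF strict_power level_power] assms by (auto simp: strict_def)


section \<open>Unitriangular matrices, the Cayley transform and the exponential\<close>

text \<open>The Neumann series of g = 1 - (1 - g), which ends because 1 - g is nilpotent for
  unitriangular g.\<close>

definition uinv :: "nat \<Rightarrow> 'a::ring_1 inc \<Rightarrow> 'a inc" where
  "uinv m g = (\<Sum>i<m. (1 - g) ^ i)"

lemma geometric_sum_ring:
  fixes y :: "'a::ring_1"
  shows "(1 - y) * (\<Sum>i<m. y ^ i) = 1 - y ^ m" "(\<Sum>i<m. y ^ i) * (1 - y) = 1 - y ^ m"
  by (induction m) (simp_all add: distrib_left distrib_right,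
    simp_all add: left_diff_distrib right_diff_distrib power_commutes)

lemma uinv_inverse:
  fixes g :: "'a::ring_1 inc"
  assumes "g - 1 \<in> strict m" "0 < m"
  shows "g * uinv m g = 1" "uinv m g * g = 1"
proof -
  have "- (g - 1) \<in> strict m" using assms by blast
  then have "(1 - g) ^ m = 0" using strict_nilpotent[of "1 - g" m m] assms(2) by simp
  then show "g * uinv m g = 1" "uinv m g * g = 1"
    using geometric_sum_ring[of "1 - g" m] by (simp_all add: uinv_def)
qed

lemma uinv_strict:
  fixes g :: "'a::ring_1 inc"
  assumes "g - 1 \<in> strict m" "0 < m"
  shows "uinv m g - 1 \<in> strict m"
proof -
  have g: "- (g - 1) \<in> strict m" using assms by blast
  have "uinv m g = 1 + (\<Sum>i\<in>{1..<m}. (1 - g) ^ i)"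
    using assms(2) by (simp add: uinv_def lessThan_atLeast0 sum.atLeast_Suc_lessThan)
  moreover have "(\<Sum>i\<in>{1..<m}. (1 - g) ^ i) \<in> strict m"
    using g by (intro strict_sum strict_power) auto
  ultimately show ?thesis by simp
qed

lemma star_uinv: "star c (uinv m g) = uinv m (star c (g :: 'a::comm_ring_1 inc))"
  by (simp add: uinv_def)

lemma inverse_commute:
  "(a :: 'a::ring_1) * b = 1 \<Longrightarrow> b * a = 1 \<Longrightarrow> a * y = y * a \<Longrightarrow> b * y = y * b"
  by (metis mult.assoc mult_1_left mult_1_right)

section \<open>Skew elements, the orthogonal group and the Cayley transform\<close>

definition skews :: "nat \<Rightarrow> 'a::ring_1 inc set" where
  "skews m = {x \<in> strict m. star (int m - 1) x = - x}"

definition orth_group :: "nat \<Rightarrow> 'a::ring_1 inc set" where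
  "orth_group m = {g. g - 1 \<in> strict m \<and>
     star (int m - 1) g * g = 1 \<and> g * star (int m - 1) g = 1}"

definition cayley :: "nat \<Rightarrow> 'a::ring_1 inc \<Rightarrow> 'a inc" where
  "cayley m x = (1 + x) * uinv m (1 - x)"

lemma strict_unip_mult:
  fixes g h :: "'a::ring_1 inc"
  assumes "g - 1 \<in> strict m" "h - 1 \<in> strict m"
  shows "g * h - 1 \<in> strict m"
proof -
  have "g * h - 1 = (g - 1) * (h - 1) + (g - 1) + (h - 1)" by (simp add: algebra_simps)
  then show ?thesis using assms by (metis strict_closed(2,6))
qed

lemma orth_group_mult:
  fixes g h :: "'a::comm_ring_1 inc"
  assumes "g \<in> orth_group m" "h \<in> orth_group m"
  shows "g * h \<in> orth_group m"
proof -
  let ?s = "star (int m - 1)"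
  have "?s h * ?s g * (g * h) = ?s h * (?s g * g) * h"
    and "g * h * (?s h * ?s g) = g * (h * ?s h) * ?s g"
    by (simp_all add: mult.assoc)
  then show ?thesis
    using assms by (simp add: orth_group_def strict_unip_mult)
qed

lemma orth_group_star:
  fixes g :: "'a::comm_ring_1 inc"
  assumes "g \<in> orth_group m"
  shows "star (int m - 1) g \<in> orth_group m"
  using assms star_strict[of "g - 1" m] by (simp add: orth_group_def)

text \<open>For g in G this is conjugation by the inverse of g. As a congruence it preserves
  skewness for every unitriangular g, and it is needed in this generality for 1 - x and its
  inverse.\<close>

lemma skews_conj:
  fixes x g :: "'a::comm_ring_1 inc"
  assumes "x \<in> skews m" "g - 1 \<in> strict m"
  shows "star (int m - 1) g * x * g \<in> skews m"
proof -
  let ?s = "star (int m - 1)"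
  have "?s g - 1 \<in> strict m" using star_strict[OF assms(2)] by simp
  moreover have "?s g * x * g = (?s g - 1) * x * (g - 1) + (?s g - 1) * x + x * (g - 1) + x"
    by (simp add: algebra_simps)
  moreover have "x \<in> strict m" using assms by (simp add: skews_def)
  ultimately have "?s g * x * g \<in> strict m"
    using assms(2) by (metis strict_closed(2,6))
  then show ?thesis using assms by (simp add: skews_def mult.assoc)
qed

lemma cayley_strict:
  fixes x :: "'a::comm_ring_1 inc"
  assumes "x \<in> skews m" "0 < m"
  shows "1 - x - 1 \<in> strict m" "1 + x - 1 \<in> strict m" "cayley m x - 1 \<in> strict m"
proof -
  show 1: "1 - x - 1 \<in> strict m" and 2: "1 + x - 1 \<in> strict m"
    using assms by (auto simp: skews_def)
  show "cayley m x - 1 \<in> strict m"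
    unfolding cayley_def by (intro strict_unip_mult uinv_strict 1 2 assms)
qed

lemma cayley_eq:
  fixes x :: "'a::comm_ring_1 inc"
  assumes "x \<in> skews m" "0 < m"
  shows "cayley m x * (1 - x) = 1 + x"
  using uinv_inverse[OF cayley_strict(1)[OF assms] assms(2)] by (simp add: cayley_def mult.assoc)

text \<open>The reflection exchanges 1 + x and 1 - x and reverses products, so it sends the Cayley
  transform to (1 + x)^-1 (1 - x). This is its inverse, because all factors involved
  commute.\<close>

lemma cayley_in_orth_group:
  fixes x :: "'a::comm_ring_1 inc"
  assumes "x \<in> skews m" "0 < m"
  shows "cayley m x \<in> orth_group m"
proof -
  let ?s = "star (int m - 1)" and ?a = "1 - x" and ?b = "1 + x"
  note a = uinv_inverse[OF cayley_strict(1)[OF assms] assms(2)]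
  note b = uinv_inverse[OF cayley_strict(2)[OF assms] assms(2)]
  have sx: "?s x = - x" using assms by (simp add: skews_def)
  have s: "?s (cayley m x) = uinv m ?b * ?a"
    by (simp add: cayley_def star_uinv sx)
  have ab: "?a * ?b = ?b * ?a" by (simp add: algebra_simps)
  have aub: "?a * uinv m ?b = uinv m ?b * ?a"
    using inverse_commute[OF b, of ?a] ab by simp
  have "?s (cayley m x) * cayley m x = uinv m ?b * (?a * ?b) * uinv m ?a"
    unfolding s by (simp only: cayley_def mult.assoc)
  also have "\<dots> = (uinv m ?b * ?b) * (?a * uinv m ?a)"
    unfolding ab by (simp only: mult.assoc)
  also have "\<dots> = 1" using a b by simp
  finally have 1: "?s (cayley m x) * cayley m x = 1" .
  have "cayley m x * ?s (cayley m x) = ?b * (uinv m ?a * ?a) * uinv m ?b"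
    unfolding s aub[symmetric] by (simp only: cayley_def mult.assoc)
  also have "\<dots> = 1" using a b by simp
  finally show ?thesis using 1 cayley_strict(3)[OF assms] by (simp add: orth_group_def)
qed

lemma scal_half:
  assumes "(2 :: 'a::field) \<noteq> 0"
  shows "scal (1 / 2 :: 'a) * (x + x) = x"
proof (rule inc_eqI)
  fix r s :: int
  have "1 / 2 * (entry x r s + entry x r s) = (1 / 2 * 2) * entry x r s"
    by (simp only: mult_2 mult.assoc)
  then show "entry (scal (1 / 2) * (x + x)) r s = entry x r s" using assms by simp
qed

lemma half_one_plus:
  fixes g :: "'a::field inc"
  assumes "(2 :: 'a) \<noteq> 0"
  shows "scal (1 / 2) * (1 + g) - 1 = scal (1 / 2) * (g - 1)"
proof -
  have "1 + g = (1 + 1) + (g - 1)" by simp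
  then show ?thesis using scal_half[OF assms, of 1] by (simp only: distrib_left) simp
qed

text \<open>The diagonal entries of 1 + g are 2, so half of 1 + g is unitriangular and has a Neumann
  series as its inverse.\<close>

lemma one_plus_unip_inverse:
  fixes g :: "'a::field inc"
  assumes "(2 :: 'a) \<noteq> 0" "g - 1 \<in> strict m" "0 < m"
  obtains h where "(1 + g) * h = 1" "h * (1 + g) = 1"
proof -
  let ?c = "scal (1 / 2 :: 'a)"
  have k: "?c * (1 + g) - 1 \<in> strict m" using assms half_one_plus[of g] by auto
  show thesis
  proof (rule that)
    show "(1 + g) * (?c * uinv m (?c * (1 + g))) = 1"
      using uinv_inverse(1)[OF k assms(3)] by (simp only: scal_left_commute mult.assoc)
    show "(?c * uinv m (?c * (1 + g))) * (1 + g) = 1"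
      using uinv_inverse(2)[OF k assms(3)] by (simp only: scal_left_commute mult.assoc)
  qed
qed

text \<open>The relation g (1 - x) = 1 + x is the same as (1 + g) x = g - 1, and 1 + g can be
  cancelled.\<close>

lemma inj_on_cayley:
  assumes "(2 :: 'a::field) \<noteq> 0" "0 < m"
  shows "inj_on (cayley m) (skews m :: 'a inc set)"
proof (rule inj_onI)
  fix x y :: "'a inc" assume x: "x \<in> skews m" and y: "y \<in> skews m" and eq: "cayley m x = cayley m y"
  let ?g = "cayley m x"
  obtain h where h: "h * (1 + ?g) = 1"
    using one_plus_unip_inverse[OF assms(1) cayley_strict(3)[OF x assms(2)] assms(2)] by metis
  have "?g * (1 - x) - 1 - x = ?g * (1 - y) - 1 - y"
    using cayley_eq[OF x assms(2)] cayley_eq[OF y assms(2)] eq by simp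
  then have "(1 + ?g) * x = (1 + ?g) * y" by (simp add: algebra_simps)
  then show "x = y" by (metis h mult.assoc mult_1_left)
qed

lemma cayley_surj:
  fixes g :: "'a::field inc"
  assumes two: "(2 :: 'a) \<noteq> 0" and m: "0 < m" and g: "g \<in> orth_group m"
  shows "\<exists>x\<in>skews m. cayley m x = g"
proof -
  let ?s = "star (int m - 1)"
  have gs: "g - 1 \<in> strict m" and sg: "?s g * g = 1" using g by (auto simp: orth_group_def)
  obtain h where h: "(1 + g) * h = 1" "h * (1 + g) = 1"
    using one_plus_unip_inverse[OF two gs m] by metis
  \<comment> \<open>The inverse Cayley transform: the solution of g (1 - x) = 1 + x.\<close>
  define x where "x = h * (g - 1)"
  have gx: "(1 + g) * x = g - 1" unfolding x_def using h by (metis mult.assoc mult_1_left)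
  have xg: "x * (1 + g) = g - 1"
  proof -
    have "x * (1 + g) = h * ((1 + g) * (g - 1))" by (simp add: x_def algebra_simps)
    then show ?thesis using h by (metis mult.assoc mult_1_left)
  qed
  have "?s x * (1 + ?s g) = ?s g - 1"
    using arg_cong[OF gx, of ?s] by simp
  then have "?s x * ((1 + ?s g) * g) = (?s g - 1) * g" by (simp only: mult.assoc[symmetric])
  then have "?s x * (1 + g) = 1 - g" using sg by (simp add: algebra_simps)
  then have "(?s x + x) * (1 + g) = 0" using xg by (simp add: distrib_right)
  then have "(?s x + x) * ((1 + g) * h) = 0" by (simp only: mult.assoc[symmetric] mult_zero_left)
  then have "?s x + x = 0" using h by simp
  then have sx: "?s x = - x" by (simp add: eq_neg_iff_add_eq_0)
  \<comment> \<open>Of \<open>h\<close> only the inverse property is known. Half of 1 + g has an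
    explicit inverse, which is unitriangular, and through it x is seen to be strict.\<close>
  have "x \<in> strict m"
  proof -
    let ?k = "scal (1 / 2) * (1 + g)"
    have k: "?k - 1 \<in> strict m" using gs half_one_plus[OF two, of g] by auto
    have "?k * x = scal (1 / 2) * (g - 1)" using gx by (simp add: mult.assoc)
    then have "uinv m ?k * (?k * x) = uinv m ?k * (scal (1 / 2) * (g - 1))" by (rule arg_cong)
    then have "x = uinv m ?k * (scal (1 / 2) * (g - 1))"
      using uinv_inverse[OF k m] by (simp only: mult.assoc[symmetric] mult_1_left)
    also have "\<dots> = (uinv m ?k - 1) * (scal (1 / 2) * (g - 1)) + scal (1 / 2) * (g - 1)"
      by (simp add: algebra_simps)
    also have "\<dots> \<in> strict m" using gs uinv_strict[OF k m] by blast
    finally show ?thesis .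
  qed
  then have x: "x \<in> skews m" using sx by (simp add: skews_def)
  have "g * (1 - x) = 1 + x" using gx by (simp add: algebra_simps)
  then have "cayley m x = (g * (1 - x)) * uinv m (1 - x)" by (simp add: cayley_def)
  then have "cayley m x = g * ((1 - x) * uinv m (1 - x))" by (simp only: mult.assoc)
  then have "cayley m x = g" using uinv_inverse[OF cayley_strict(1)[OF x m] m] by simp
  then show ?thesis using x by blast
qed

lemma bij_betw_cayley:
  assumes "(2 :: 'a::field) \<noteq> 0" "0 < m"
  shows "bij_betw (cayley m) (skews m :: 'a inc set) (orth_group m)"
  using inj_on_cayley[OF assms] cayley_in_orth_group[OF _ assms(2)] cayley_surj[OF assms]
  unfolding bij_betw_def by blast

section \<open>The truncated exponential\<close>

definition expm :: "nat \<Rightarrow> 'a::field inc \<Rightarrow> 'a inc" where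
  "expm m x = (\<Sum>i<m. scal (1 / of_nat (fact i)) * x ^ i)"

lemma scal_sum: "scal (sum f A) = (\<Sum>a\<in>A. scal (f a :: 'a::ring_1))"
  by (induction A rule: infinite_finite_induct) (simp_all add: scal_hom)

lemma scal_minus_one_power: "scal ((- 1) ^ i :: 'a::comm_ring_1) = (- 1) ^ i"
  by (induction i) (simp_all add: scal_hom)

text \<open>The coefficient of x^k in exp(-x) exp(x). Multiplied by k! it is the alternating sum of
  the binomial coefficients; i! and (k - i)! are nonzero because they divide k!.\<close>

lemma exp_coeff_convolution:
  assumes "of_nat (fact k) \<noteq> (0 :: 'a::field)"
  shows "(\<Sum>i\<le>k. ((- 1) ^ i / of_nat (fact i)) * (1 / of_nat (fact (k - i)))) =
    (if k = 0 then 1 else 0 :: 'a)"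
proof -
  have "((- 1) ^ i / of_nat (fact i)) * (1 / of_nat (fact (k - i))) =
      (- 1) ^ i * of_nat (k choose i) / (of_nat (fact k) :: 'a)" if "i \<le> k" for i
  proof -
    have eq: "of_nat (fact i) * of_nat (fact (k - i)) * of_nat (k choose i) = (of_nat (fact k) :: 'a)"
      unfolding of_nat_mult[symmetric] binomial_fact_lemma[OF that] ..
    then have "of_nat (fact i) \<noteq> (0 :: 'a)" "of_nat (fact (k - i)) \<noteq> (0 :: 'a)"
      using assms by auto
    then show ?thesis using assms eq[symmetric] by (simp add: divide_simps ac_simps)
  qed
  then have "(\<Sum>i\<le>k. ((- 1) ^ i / of_nat (fact i)) * (1 / of_nat (fact (k - i)))) =
      (\<Sum>i\<le>k. (- 1) ^ i * of_nat (k choose i)) / (of_nat (fact k) :: 'a)"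
    unfolding sum_divide_distrib by (intro sum.cong) auto
  then show ?thesis using choose_alternating_sum[of k, where 'a = 'a] by (cases k) auto
qed

lemma expm_inverse:
  fixes x :: "'a::field inc"
  assumes fact: "\<And>i. i < m \<Longrightarrow> of_nat (fact i) \<noteq> (0 :: 'a)" and x: "x \<in> strict m" and m: "0 < m"
  shows "expm m (- x) * expm m x = 1"
proof -
  define a where "a i = (1 / of_nat (fact i) :: 'a)" for i
  define b where "b i = ((- 1) ^ i / of_nat (fact i) :: 'a)" for i
  define g where "g i j = scal (b i * a j) * x ^ (i + j)" for i j
  have minus: "scal (a i) * (- x) ^ i = scal (b i) * x ^ i" for i
  proof -
    have "scal (b i) = scal (a i) * (- 1) ^ i"
      unfolding scal_minus_one_power[symmetric] scal_hom(3)[symmetric] by (simp add: a_def b_def)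
    then show ?thesis by (simp add: power_minus[of x] mult.assoc)
  qed
  have "expm m (- x) * expm m x = (\<Sum>i<m. \<Sum>j<m. (scal (b i) * x ^ i) * (scal (a j) * x ^ j))"
    by (simp add: expm_def a_def[symmetric] minus sum_product)
  also have "\<dots> = (\<Sum>(i, j)\<in>{..<m} \<times> {..<m}. g i j)"
    by (simp add: sum.cartesian_product scal_mult_mult g_def power_add)
  \<comment> \<open>Nilpotency kills the products beyond degree m - 1, so the square of index pairs
    shrinks to a triangle, which is then summed by total degree.\<close>
  also have "\<dots> = (\<Sum>(i, j)\<in>{(i, j). i + j < m}. g i j)"
  proof -
    have "g i j = 0" if "\<not> i + j < m" for i j
    proof -
      have "x ^ (i + j) = 0" using that m by (intro strict_nilpotent[OF x]) linarith+
      then show ?thesis by (simp add: g_def)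
    qed
    then show ?thesis by (intro sum.mono_neutral_right) auto
  qed
  also have "\<dots> = (\<Sum>k<m. \<Sum>i\<le>k. g i (k - i))"
    by (rule sum.triangle_reindex)
  also have "\<dots> = (\<Sum>k<m. if k = 0 then 1 else 0)"
  proof (intro sum.cong refl)
    fix k assume "k \<in> {..<m}"
    have "(\<Sum>i\<le>k. g i (k - i)) = scal (\<Sum>i\<le>k. b i * a (k - i)) * x ^ k"
      by (simp add: g_def scal_sum sum_distrib_right)
    also have "(\<Sum>i\<le>k. b i * a (k - i)) = (if k = 0 then 1 else 0)"
      unfolding a_def b_def using fact[of k] \<open>k \<in> {..<m}\<close> by (intro exp_coeff_convolution) auto
    finally show "(\<Sum>i\<le>k. g i (k - i)) = (if k = 0 then 1 else 0)" by (simp add: scal_hom)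
  qed
  also have "\<dots> = 1" using m by simp
  finally show ?thesis .
qed

lemma expm_split:
  assumes "2 \<le> m"
  shows "expm m x = 1 + x + (\<Sum>i\<in>{2..<m}. scal (1 / of_nat (fact i)) * x ^ i)"
proof -
  have "{..<m} = insert 0 (insert 1 {2..<m})" using assms by auto
  then show ?thesis by (simp add: expm_def scal_hom add.assoc)
qed

lemma expm_strict:
  assumes "x \<in> strict m" "2 \<le> m"
  shows "expm m x - 1 \<in> strict m"
proof -
  have "expm m x - 1 = x + (\<Sum>i\<in>{2..<m}. scal (1 / of_nat (fact i)) * x ^ i)"
    using expm_split[OF assms(2), of x] by simp
  also have "\<dots> \<in> strict m"
    using assms by (intro strict_closed(2,5) strict_sum strict_power) auto
  finally show ?thesis .
qed

text \<open>The difference of powers telescopes, and each further factor x or y pushes it down by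
  one subdiagonal.\<close>

lemma level_power_diff:
  fixes x y :: "'a::ring_1 inc"
  assumes "level 1 x" "level 1 y" "level l (x - y)"
  shows "level (k + l) (x ^ Suc k - y ^ Suc k)"
proof (induction k)
  case (Suc k)
  have "x ^ Suc (Suc k) - y ^ Suc (Suc k) = x * (x ^ Suc k - y ^ Suc k) + (x - y) * y ^ Suc k"
    by (simp add: algebra_simps)
  moreover have "level (1 + (k + l)) (x * (x ^ Suc k - y ^ Suc k))"
    by (intro level_mult assms Suc)
  moreover have "level (l + Suc k) ((x - y) * y ^ Suc k)"
    by (intro level_mult assms level_power)
  ultimately show ?case by (metis add.commute add_Suc_right level_closed(2) plus_1_eq_Suc)
qed (use assms in simp)

text \<open>Successive approximation in place of a logarithm: if x - y has level l, the differences
  of all higher powers have level l + 1. Equality of the exponentials expresses x - y through these,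
  so x - y has level l + 1 as well, and eventually it vanishes.\<close>

lemma inj_on_expm:
  assumes "2 \<le> m"
  shows "inj_on (expm m) (strict m)"
proof (rule inj_onI)
  fix x y :: "'a inc" assume xy: "x \<in> strict m" "y \<in> strict m" "expm m x = expm m y"
  let ?t = "\<lambda>x i. scal (1 / of_nat (fact i)) * x ^ i"
  have lev1: "level 1 x" "level 1 y" using xy by (auto simp: strict_def)
  have eq: "x - y = - (\<Sum>i\<in>{2..<m}. scal (1 / of_nat (fact i)) * (x ^ i - y ^ i))"
    using xy(3) unfolding expm_split[OF assms] right_diff_distrib sum_subtractf
    by (simp add: algebra_simps)
  have "level l (x - y)" for l
  proof (induction l)
    case 0 then show ?case using level_mono[OF level_closed(3)[OF lev1]] by auto
  next
    case (Suc l)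
    have "level (Suc l) (x ^ i - y ^ i)" if "2 \<le> i" for i
      using level_power_diff[OF lev1 Suc, of "i - 1"] that by (auto intro: level_mono)
    then show ?case by (subst eq) (auto intro!: level_closed(4,5) level_sum)
  qed
  then have "x - y = 0" using strict_level_zero[of "x - y" m m] xy by blast
  then show "x = y" by simp
qed

lemma star_expm: "star c (expm m x) = expm m (star c x)"
  by (simp add: expm_def scal_commute)

lemma expm_image_skews:
  assumes fact: "\<And>i. i < m \<Longrightarrow> of_nat (fact i) \<noteq> (0 :: 'a::field)" and m: "3 \<le> m"
    and fin: "finite (skews m :: 'a inc set)"
  shows "expm m ` skews m = (orth_group m :: 'a inc set)"
proof (rule card_subset_eq)
  have two: "(2 :: 'a) \<noteq> 0" using fact[of 2] m by (simp add: fact_2)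
  note bij = bij_betw_cayley[OF two, of m]
  show "finite (orth_group m :: 'a inc set)"
    using bij fin m by (simp add: bij_betw_finite)
  show "expm m ` skews m \<subseteq> (orth_group m :: 'a inc set)"
  proof
    fix g assume "g \<in> expm m ` (skews m :: 'a inc set)"
    then obtain x where x: "x \<in> skews m" "g = expm m x" by blast
    have xs: "x \<in> strict m" "- x \<in> strict m" and sx: "star (int m - 1) x = - x"
      using x by (auto simp: skews_def)
    show "g \<in> orth_group m"
      using expm_inverse[OF fact xs(1)] expm_inverse[OF fact xs(2)] expm_strict[OF xs(1)] m
      by (simp add: orth_group_def x star_expm sx)
  qed
  have "inj_on (expm m) (skews m :: 'a inc set)"
    using inj_on_expm[of m, where 'a = 'a] m by (auto simp: skews_def intro: inj_on_subset)
  from card_image[OF this] show "card (expm m ` (skews m :: 'a inc set)) = card (orth_group m :: 'a inc set)"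
    using bij_betw_same_card[OF bij] m by simp
qed

section \<open>Orbits and the radical of the form\<close>

lemma card_fibers:
  assumes "finite A" "\<And>x. x \<in> A \<Longrightarrow> card {y \<in> A. f y = f x} = c"
  shows "card A = card (f ` A) * c"
proof -
  have "card A = (\<Sum>z\<in>f ` A. \<Sum>y\<in>{y \<in> A. f y = z}. 1)"
    using sum.image_gen[OF assms(1), of "\<lambda>_. 1 :: nat" f] by simp
  also have "\<dots> = (\<Sum>z\<in>f ` A. c)"
    using assms(2) by (intro sum.cong) auto
  finally show ?thesis by simp
qed

definition stab :: "nat \<Rightarrow> ('a inc \<Rightarrow> 'a) \<Rightarrow> 'a::field inc set" where
  "stab m f = {g \<in> orth_group m. \<forall>y\<in>skews m. f (star (int m - 1) g * y * g) = f y}"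

definition form_radical :: "nat \<Rightarrow> ('a inc \<Rightarrow> 'a) \<Rightarrow> 'a::field inc set" where
  "form_radical m f = {x \<in> skews m. \<forall>z\<in>skews m. f (x * z - z * x) = 0}"

lemma cayley_mem_stab_iff:
  fixes x :: "'a::field inc"
  assumes add: "\<And>x y. f (x + y) = f x + f y" and two: "(2 :: 'a) \<noteq> 0" and m: "0 < m"
    and x: "x \<in> skews m"
  shows "cayley m x \<in> stab m f \<longleftrightarrow> x \<in> form_radical m f"
proof -
  let ?s = "star (int m - 1)" and ?g = "cayley m x"
  have sx: "?s x = - x" using x by (simp add: skews_def)
  note a1 = cayley_strict(1)[OF x m]
  note a = uinv_inverse[OF a1 m]
  have "(1 - x) * ?g = (1 + x) * ((1 - x) * uinv m (1 - x))"
    by (simp add: cayley_def algebra_simps)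
  then have g1: "(1 - x) * ?g = 1 + x" using a by simp
  then have "?s ((1 - x) * ?g) = ?s (1 + x)" by simp
  then have g2: "?s ?g * (1 + x) = 1 - x" by (simp add: sx)
  have diff: "f ((1 + x) * z * (1 - x)) - f (?s ?g * ((1 + x) * z * (1 - x)) * ?g) = 2 * f (x * z - z * x)"
    for z
  proof -
    have "?s ?g * ((1 + x) * z * (1 - x)) * ?g = (?s ?g * (1 + x)) * z * ((1 - x) * ?g)"
      by (simp only: mult.assoc)
    also have "\<dots> = (1 - x) * z * (1 + x)" by (simp only: g1 g2)
    finally have "(1 + x) * z * (1 - x) =
        ?s ?g * ((1 + x) * z * (1 - x)) * ?g + ((x * z - z * x) + (x * z - z * x))"
      by (simp add: algebra_simps)
    then have "f ((1 + x) * z * (1 - x)) =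
        f (?s ?g * ((1 + x) * z * (1 - x)) * ?g) + (f (x * z - z * x) + f (x * z - z * x))"
      using add by metis
    then show ?thesis by simp
  qed
  \<comment> \<open>Since 1 + x is the reflection of 1 - x, the substitution of y by z is a
    congruence by a unitriangular element. The congruence by \<open>?u\<close>, the inverse of 1 -
    x, undoes it.\<close>
  have onto: "\<exists>z\<in>skews m. y = (1 + x) * z * (1 - x)" if "y \<in> skews m" for y
  proof
    let ?u = "uinv m (1 - x)"
    show "?s ?u * y * ?u \<in> skews m" by (intro skews_conj that uinv_strict a1 m)
    have "?s (?u * (1 - x)) = 1" using a by simp
    then have su: "(1 + x) * ?s ?u = 1" by (simp add: sx)
    have "(1 + x) * (?s ?u * y * ?u) * (1 - x) = ((1 + x) * ?s ?u) * y * (?u * (1 - x))"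
      by (simp only: mult.assoc)
    then show "y = (1 + x) * (?s ?u * y * ?u) * (1 - x)" using su a by simp
  qed
  have into: "(1 + x) * z * (1 - x) \<in> skews m" if "z \<in> skews m" for z
    using skews_conj[OF that a1] by (simp add: sx)
  have "?g \<in> stab m f \<longleftrightarrow> (\<forall>y\<in>skews m. f y - f (?s ?g * y * ?g) = 0)"
    using cayley_in_orth_group[OF x m] by (auto simp: stab_def)
  also have "\<dots> \<longleftrightarrow> (\<forall>z\<in>skews m. 2 * f (x * z - z * x) = 0)"
    unfolding diff[symmetric] using onto into by metis
  also have "\<dots> \<longleftrightarrow> x \<in> form_radical m f" using x two by (simp add: form_radical_def)
  finally show ?thesis .
qed

text \<open>The orbit-stabiliser count: the fibre of the orbit map through g is the coset of g
  modulo the stabiliser, and the Cayley transform carries the radical bijectively onto the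
  stabiliser, although it is no homomorphism.\<close>

lemma card_orbit_times_card_radical:
  fixes f :: "'a::field inc \<Rightarrow> 'a"
  assumes add: "\<And>x y. f (x + y) = f x + f y" and two: "(2 :: 'a) \<noteq> 0" and m: "0 < m"
    and fin: "finite (skews m :: 'a inc set)"
  shows "card ((\<lambda>g. \<lambda>y\<in>skews m. f (star (int m - 1) g * y * g)) ` orth_group m)
    * card (form_radical m f) = card (skews m :: 'a inc set)"
proof -
  let ?s = "star (int m - 1)"
  let ?act = "\<lambda>g. \<lambda>y\<in>skews m. f (?s g * y * g)"
  note bij = bij_betw_cayley[OF two m]
  have finG: "finite (orth_group m :: 'a inc set)" using bij fin by (simp add: bij_betw_finite)
  have "cayley m ` form_radical m f = stab m f"
  proof (intro equalityI subsetI)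
    fix g assume "g \<in> cayley m ` form_radical m f"
    then obtain x where x: "x \<in> form_radical m f" "g = cayley m x" by blast
    then have "x \<in> skews m" by (simp add: form_radical_def)
    then show "g \<in> stab m f" using cayley_mem_stab_iff[of f, OF add two m] x by blast
  next
    fix g assume g: "g \<in> stab m f"
    then have "g \<in> cayley m ` skews m" using bij by (simp add: bij_betw_def stab_def)
    then obtain x where x: "x \<in> skews m" "g = cayley m x" by blast
    then show "g \<in> cayley m ` form_radical m f" using cayley_mem_stab_iff[of f, OF add two m] g by blast
  qed
  moreover have "inj_on (cayley m) (form_radical m f)"
    using bij by (auto simp: bij_betw_def form_radical_def intro: inj_on_subset)
  ultimately have card_stab: "card (stab m f) = card (form_radical m f)"
    by (metis card_image)
  have "card {h \<in> orth_group m. ?act h = ?act g} = card (stab m f)" if g: "g \<in> orth_group m" for g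
  proof -
    have gg: "?s g * g = 1" "g * ?s g = 1" and gs: "g - 1 \<in> strict m" "?s g - 1 \<in> strict m"
      using g orth_group_star[OF g] by (auto simp: orth_group_def)
    have conj: "?act (g * k) = ?act g \<longleftrightarrow> (\<forall>y\<in>skews m. f (?s k * y * k) = f y)" for k
    proof -
      have "?act (g * k) = ?act g \<longleftrightarrow> (\<forall>y\<in>skews m. f (?s k * (?s g * y * g) * k) = f (?s g * y * g))"
        by (auto simp: fun_eq_iff restrict_def mult.assoc)
      also have "\<dots> \<longleftrightarrow> (\<forall>y\<in>skews m. f (?s k * y * k) = f y)"
      proof (intro iffI ballI)
        fix y :: "'a inc" assume *: "\<forall>y\<in>skews m. f (?s k * (?s g * y * g) * k) = f (?s g * y * g)"
          and y: "y \<in> skews m"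
        have "g * y * ?s g \<in> skews m" using skews_conj[OF y gs(2)] by simp
        moreover have "?s g * (g * y * ?s g) * g = (?s g * g) * y * (?s g * g)"
          by (simp only: mult.assoc)
        ultimately show "f (?s k * y * k) = f y" using * gg by force
      qed (use skews_conj gs(1) in blast)
      finally show ?thesis .
    qed
    have "{h \<in> orth_group m. ?act h = ?act g} = (*) g ` stab m f"
    proof (intro equalityI subsetI)
      fix h assume h: "h \<in> {h \<in> orth_group m. ?act h = ?act g}"
      have hg: "h = g * (?s g * h)" using gg by (simp add: mult.assoc[symmetric])
      then have "\<forall>y\<in>skews m. f (?s (?s g * h) * y * (?s g * h)) = f y"
        using h conj[of "?s g * h"] by simp
      then have "?s g * h \<in> stab m f"
        using orth_group_mult[OF orth_group_star[OF g]] h by (simp add: stab_def)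
      then show "h \<in> (*) g ` stab m f" using hg by blast
    next
      fix h assume "h \<in> (*) g ` stab m f"
      then obtain k where "h = g * k" "k \<in> stab m f" by blast
      then show "h \<in> {h \<in> orth_group m. ?act h = ?act g}"
        using conj[of k] orth_group_mult[OF g] by (simp add: stab_def)
    qed
    moreover have "inj_on ((*) g) (stab m f)"
    proof (rule inj_onI)
      fix h k assume "g * h = g * k"
      then have "?s g * (g * h) = ?s g * (g * k)" by simp
      then show "h = k" using gg by (simp add: mult.assoc[symmetric])
    qed
    ultimately show ?thesis by (simp add: card_image)
  qed
  from card_fibers[OF finG, of ?act, OF this]
  show ?thesis using card_stab bij_betw_same_card[OF bij] by simp
qed

section \<open>Sums of positive roots\<close>

text \<open>\<open>splits \<gamma> \<delta> \<beta>\<close> says that $\gamma + \delta = \beta$ with $\gamma \in S^+(\beta)$.\<close>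

fun splits :: "root \<Rightarrow> root \<Rightarrow> root \<Rightarrow> bool" where
  "splits (Diff i k) (Diff k' j) (Diff i' j') \<longleftrightarrow> i = i' \<and> k = k' \<and> j = j'"
| "splits (Diff i k) (Short k') (Short i') \<longleftrightarrow> i = i' \<and> k = k'"
| "splits (Diff i k) (Add k' j) (Add i' j') \<longleftrightarrow> i = i' \<and> (k = k' \<and> j = j' \<or> k = j \<and> k' = j')"
| "splits (Add i k) (Diff j k') (Add i' j') \<longleftrightarrow> i = i' \<and> k = k' \<and> j = j'"
| "splits (Short i) (Short j) (Add i' j') \<longleftrightarrow> i = i' \<and> j = j'"
| "splits _ _ _ \<longleftrightarrow> False"

fun coef :: "root \<Rightarrow> nat \<Rightarrow> int" where
  "coef (Short i) k = (if k = i then 1 else 0)"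
| "coef (Diff i j) k = (if k = i then 1 else 0) - (if k = j then 1 else 0)"
| "coef (Add i j) k = (if k = i then 1 else 0) + (if k = j then 1 else 0)"

lemma mem_pos_roots_iff [simp]:
  "Diff i j \<in> pos_roots \<Phi> n \<longleftrightarrow> 1 \<le> i \<and> i < j \<and> j \<le> n"
  "Add i j \<in> pos_roots \<Phi> n \<longleftrightarrow> 1 \<le> i \<and> i < j \<and> j \<le> n"
  "Short i \<in> pos_roots \<Phi> n \<longleftrightarrow> \<Phi> = Type_B \<and> 1 \<le> i \<and> i \<le> n"
  by (cases \<Phi>; auto simp: pos_roots_def)+

lemma finite_pos_roots [simp]: "finite (pos_roots \<Phi> n)"
proof (rule finite_subset)
  let ?I = "{..n} \<times> {..n}"
  show "pos_roots \<Phi> n \<subseteq> (\<lambda>(i, j). Diff i j) ` ?I \<union> (\<lambda>(i, j). Add i j) ` ?I \<union> Short ` {..n}"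
    by (cases \<Phi>) (force simp: pos_roots_def)+
qed auto

lemma root_vec_index:
  assumes "\<alpha> \<in> pos_roots \<Phi> n" "k < n"
  shows "root_vec n \<alpha> $ k = real_of_int (coef \<alpha> (Suc k))"
  using assms by (cases \<alpha>) (auto simp: eps_def)

lemma dim_root_vec [simp]: "dim_vec (root_vec n \<alpha>) = n"
  by (cases \<alpha>) (auto simp: eps_def)

lemma coef_outside: "\<alpha> \<in> pos_roots \<Phi> n \<Longrightarrow> k = 0 \<or> n < k \<Longrightarrow> coef \<alpha> k = 0"
  by (cases \<alpha>) auto

lemma root_vec_add_iff_coef:
  assumes "\<alpha> \<in> pos_roots \<Phi> n" "\<gamma> \<in> pos_roots \<Phi> n" "\<beta> \<in> pos_roots \<Phi> n"
  shows "root_vec n \<alpha> + root_vec n \<gamma> = root_vec n \<beta> \<longleftrightarrow> (\<forall>k. coef \<alpha> k + coef \<gamma> k = coef \<beta> k)"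
proof
  assume eq: "root_vec n \<alpha> + root_vec n \<gamma> = root_vec n \<beta>"
  show "\<forall>k. coef \<alpha> k + coef \<gamma> k = coef \<beta> k"
  proof
    fix k
    show "coef \<alpha> k + coef \<gamma> k = coef \<beta> k"
    proof (cases "k = 0 \<or> n < k")
      case True then show ?thesis using assms[THEN coef_outside, of k] by simp
    next
      case False
      then obtain l where l: "k = Suc l" "l < n" by (cases k) auto
      then have "(root_vec n \<alpha> + root_vec n \<gamma>) $ l = root_vec n \<beta> $ l" using eq by simp
      then have "real_of_int (coef \<alpha> k + coef \<gamma> k) = real_of_int (coef \<beta> k)"
        using l assms by (simp add: root_vec_index)
      then show ?thesis by linarith
    qed
  qed
next
  assume *: "\<forall>k. coef \<alpha> k + coef \<gamma> k = coef \<beta> k"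
  show "root_vec n \<alpha> + root_vec n \<gamma> = root_vec n \<beta>"
  proof (rule eq_vecI)
    fix i assume "i < dim_vec (root_vec n \<beta>)"
    then have "(root_vec n \<alpha> + root_vec n \<gamma>) $ i = real_of_int (coef \<alpha> (Suc i) + coef \<gamma> (Suc i))"
      using assms by (simp add: root_vec_index)
    then show "(root_vec n \<alpha> + root_vec n \<gamma>) $ i = root_vec n \<beta> $ i"
      using * \<open>i < _\<close> assms by (simp add: root_vec_index)
  qed simp
qed

lemma splits_coef:
  "splits \<alpha> \<gamma> \<beta> \<Longrightarrow> coef \<alpha> k + coef \<gamma> k = coef \<beta> k"
  by (cases "(\<alpha>, \<gamma>, \<beta>)" rule: splits.cases) auto

text \<open>The positive and the negative part of a root as multisets of indices. They turn the
  equation for all coordinates into one equation between small multisets, which leaves finitely many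
  cases.\<close>

fun heads :: "root \<Rightarrow> nat multiset" where
  "heads (Short i) = {#i#}"
| "heads (Diff i j) = {#i#}"
| "heads (Add i j) = {#i, j#}"

fun tails :: "root \<Rightarrow> nat multiset" where
  "tails (Diff i j) = {#j#}"
| "tails _ = {#}"

lemma coef_eq_count: "coef \<alpha> k = int (count (heads \<alpha>) k) - int (count (tails \<alpha>) k)"
  by (cases \<alpha>) auto

lemma coef_splits:
  assumes "\<alpha> \<in> pos_roots \<Phi> n" "\<gamma> \<in> pos_roots \<Phi> n" "\<beta> \<in> pos_roots \<Phi> n"
    and "\<forall>k. coef \<alpha> k + coef \<gamma> k = coef \<beta> k"
  shows "splits \<alpha> \<gamma> \<beta> \<or> splits \<gamma> \<alpha> \<beta>"
proof -
  have "heads \<alpha> + heads \<gamma> + tails \<beta> = heads \<beta> + tails \<alpha> + tails \<gamma>"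
  proof (rule multiset_eqI)
    fix k
    show "count (heads \<alpha> + heads \<gamma> + tails \<beta>) k = count (heads \<beta> + tails \<alpha> + tails \<gamma>) k"
      using assms(4)[rule_format, of k] by (simp add: coef_eq_count)
  qed
  then show ?thesis
    using assms(1-3) by (cases \<alpha>; cases \<gamma>; cases \<beta>) (auto simp: add_eq_conv_ex)
qed

lemma root_vec_add_iff_splits:
  assumes "\<alpha> \<in> pos_roots \<Phi> n" "\<gamma> \<in> pos_roots \<Phi> n" "\<beta> \<in> pos_roots \<Phi> n"
  shows "root_vec n \<alpha> + root_vec n \<gamma> = root_vec n \<beta> \<longleftrightarrow> splits \<alpha> \<gamma> \<beta> \<or> splits \<gamma> \<alpha> \<beta>"
  unfolding root_vec_add_iff_coef[OF assms]
proof
  assume "splits \<alpha> \<gamma> \<beta> \<or> splits \<gamma> \<alpha> \<beta>"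
  then show "\<forall>k. coef \<alpha> k + coef \<gamma> k = coef \<beta> k"
    using splits_coef by (metis add.commute)
qed (rule coef_splits[OF assms])

text \<open>The first summand begins where the sum begins, the second one begins later. Every
  argument about the order in which roots become marked rests on this.\<close>

lemma splits_col:
  assumes "splits \<gamma> \<delta> \<beta>"
    and "\<gamma> \<in> pos_roots \<Phi> n" "\<delta> \<in> pos_roots \<Phi> n" "\<beta> \<in> pos_roots \<Phi> n"
  shows "root_col \<gamma> = root_col \<beta>" "root_col \<gamma> < root_col \<delta>"
proof -
  have "root_col \<gamma> = root_col \<beta> \<and> root_col \<gamma> < root_col \<delta>"
    using assms by (cases \<gamma>; cases \<delta>; cases \<beta>) (simp_all, linarith)
  then show "root_col \<gamma> = root_col \<beta>" "root_col \<gamma> < root_col \<delta>" by simp_all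
qed

lemma splits_unique:
  assumes "\<gamma> \<in> pos_roots \<Phi> n" "\<delta> \<in> pos_roots \<Phi> n" "\<delta>' \<in> pos_roots \<Phi> n"
  shows "splits \<gamma> \<delta> \<beta> \<Longrightarrow> splits \<gamma> \<delta>' \<beta> \<Longrightarrow> \<delta> = \<delta>'"
    "splits \<delta> \<gamma> \<beta> \<Longrightarrow> splits \<delta>' \<gamma> \<beta> \<Longrightarrow> \<delta> = \<delta>'"
  using assms by (cases \<gamma>; cases \<delta>; cases \<delta>'; cases \<beta>; auto)+

section \<open>Elimination along the diagram\<close>

text \<open>The number of kernel vectors over a finite field stands in for the rank. Deleting rows
  and columns only shrinks \<open>V\<close> and leaves \<open>M\<close> unchanged.\<close>

definition left_kernel :: "'b set \<Rightarrow> ('b \<Rightarrow> 'b \<Rightarrow> 'a::field) \<Rightarrow> ('b \<Rightarrow> 'a) set" where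
  "left_kernel V M = {x \<in> V \<rightarrow>\<^sub>E UNIV. \<forall>b\<in>V. (\<Sum>a\<in>V. x a * M a b) = 0}"

text \<open>Column \<gamma> of the system has its only nonzero entry in row \<delta> and forces
  \<open>x \<delta> = 0\<close>. Column \<delta> then determines \<open>x \<gamma>\<close> by the
  remaining coordinates, and row \<gamma> does not enter any other equation. Restriction to the
  remaining indices is thus a bijection of kernels.\<close>

lemma card_left_kernel_eliminate:
  fixes M :: "'b \<Rightarrow> 'b \<Rightarrow> 'a::field"
  assumes V: "finite V" "\<gamma> \<in> V" "\<delta> \<in> V" "\<gamma> \<noteq> \<delta>"
    and zero: "\<And>b. b \<in> V \<Longrightarrow> b \<noteq> \<delta> \<Longrightarrow> M \<gamma> b = 0" "\<And>b. b \<in> V \<Longrightarrow> b \<noteq> \<delta> \<Longrightarrow> M b \<gamma> = 0"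
    and nz: "M \<gamma> \<delta> \<noteq> 0" "M \<delta> \<gamma> \<noteq> 0"
  shows "card (left_kernel V M) = card (left_kernel (V - {\<gamma>, \<delta>}) M)"
proof -
  let ?W = "V - {\<gamma>, \<delta>}"
  have sum: "(\<Sum>a\<in>V. x a * M a b) = x \<gamma> * M \<gamma> b + (x \<delta> * M \<delta> b + (\<Sum>a\<in>?W. x a * M a b))" for x b
  proof -
    have "V = insert \<gamma> (insert \<delta> ?W)" using V by auto
    then show ?thesis using V(1,4)
      by (metis (no_types, lifting) Diff_iff finite_Diff finite_insert insertCI insertE sum.insert)
  qed
  have \<delta>0: "x \<delta> = 0" if "x \<in> left_kernel V M" for x
  proof -
    have "(\<Sum>a\<in>?W. x a * M a \<gamma>) = 0" using zero(2) by (intro sum.neutral) auto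
    moreover have "(\<Sum>a\<in>V. x a * M a \<gamma>) = 0" using that V by (simp add: left_kernel_def)
    ultimately show ?thesis using sum[of x \<gamma>] zero(1)[of \<gamma>] V nz by simp
  qed
  have \<gamma>eq: "x \<gamma> = - (\<Sum>a\<in>?W. x a * M a \<delta>) / M \<gamma> \<delta>" if "x \<in> left_kernel V M" for x
  proof -
    have "(\<Sum>a\<in>V. x a * M a \<delta>) = 0" using that V by (simp add: left_kernel_def)
    then have "x \<gamma> * M \<gamma> \<delta> = - (\<Sum>a\<in>?W. x a * M a \<delta>)"
      using sum[of x \<delta>] \<delta>0[OF that] by (simp add: add_eq_0_iff)
    then show ?thesis using nz by (simp add: field_simps)
  qed
  have "bij_betw (\<lambda>x. restrict x ?W) (left_kernel V M) (left_kernel ?W M)"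
  proof (rule bij_betw_imageI)
    show "inj_on (\<lambda>x. restrict x ?W) (left_kernel V M)"
    proof (rule inj_onI)
      fix x y assume x: "x \<in> left_kernel V M" and y: "y \<in> left_kernel V M" and eq: "restrict x ?W = restrict y ?W"
      have W: "x a = y a" if "a \<in> ?W" for a using fun_cong[OF eq, of a] that by simp
      then have "(\<Sum>a\<in>?W. x a * M a \<delta>) = (\<Sum>a\<in>?W. y a * M a \<delta>)"
        by (intro sum.cong) auto
      then have "x \<gamma> = y \<gamma>" using \<gamma>eq[OF x] \<gamma>eq[OF y] by simp
      moreover have "x \<delta> = y \<delta>" using \<delta>0[OF x] \<delta>0[OF y] by simp
      ultimately have "x a = y a" if "a \<in> V" for a using W that by blast
      then show "x = y" using x y by (auto simp: left_kernel_def intro: PiE_ext)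
    qed
    show "(\<lambda>x. restrict x ?W) ` left_kernel V M = left_kernel ?W M"
    proof (intro equalityI subsetI)
      fix y assume "y \<in> (\<lambda>x. restrict x ?W) ` left_kernel V M"
      then obtain x where x: "x \<in> left_kernel V M" "y = restrict x ?W" by blast
      have "(\<Sum>a\<in>?W. y a * M a b) = 0" if "b \<in> ?W" for b
      proof -
        have "(\<Sum>a\<in>?W. y a * M a b) = (\<Sum>a\<in>?W. x a * M a b)" using x by (intro sum.cong) auto
        also have "\<dots> = (\<Sum>a\<in>V. x a * M a b)" using sum[of x b] \<delta>0[OF x(1)] zero(1)[of b] that by simp
        also have "\<dots> = 0" using x that by (simp add: left_kernel_def)
        finally show ?thesis .
      qed
      then show "y \<in> left_kernel ?W M" using x by (auto simp: left_kernel_def)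
    next
      fix y assume y: "y \<in> left_kernel ?W M"
      define x where "x a = (if a = \<delta> then 0 else if a = \<gamma> then - (\<Sum>a\<in>?W. y a * M a \<delta>) / M \<gamma> \<delta> else y a)" for a
      have W: "(\<Sum>a\<in>?W. x a * M a b) = (\<Sum>a\<in>?W. y a * M a b)" for b
        by (intro sum.cong) (auto simp: x_def)
      have s: "(\<Sum>a\<in>V. x a * M a b) = 0" if "b \<in> V" for b
      proof (cases "b = \<delta>")
        case True then show ?thesis using sum[of x b] W nz V by (simp add: x_def)
      next
        case False
        show ?thesis
        proof (cases "b = \<gamma>")
          case True
          have "(\<Sum>a\<in>?W. y a * M a \<gamma>) = 0" using zero(2) by (intro sum.neutral) auto
          then show ?thesis using sum[of x b] W zero(1)[of b] True V by (simp add: x_def)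
        next
          case False
          then have "(\<Sum>a\<in>?W. y a * M a b) = 0"
            using y that \<open>b \<noteq> \<delta>\<close> by (simp add: left_kernel_def)
          then show ?thesis using sum[of x b] W zero(1)[of b] \<open>b \<noteq> \<delta>\<close> that by (simp add: x_def)
        qed
      qed
      have "x \<in> V \<rightarrow>\<^sub>E UNIV" using y V by (auto simp: left_kernel_def x_def PiE_def extensional_def)
      then have "x \<in> left_kernel V M" using s by (simp add: left_kernel_def)
      moreover have "y = restrict x ?W" using y by (auto simp: left_kernel_def x_def PiE_def extensional_def)
      ultimately show "y \<in> (\<lambda>x. restrict x ?W) ` left_kernel V M" by blast
    qed
  qed
  then show ?thesis by (rule bij_betw_same_card)
qed

text \<open>All pairs of one battleship step are removed together. They are disjoint, so deleting
  one pair keeps the partner of every other \<gamma> in place.\<close>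

lemma card_left_kernel_eliminate_pairs:
  fixes M :: "'b \<Rightarrow> 'b \<Rightarrow> 'a::field"
  assumes "finite T" "finite V" "T \<subseteq> V \<times> V" "inj_on fst T" "inj_on snd T" "fst ` T \<inter> snd ` T = {}"
    and "\<And>\<gamma> \<delta> b. (\<gamma>, \<delta>) \<in> T \<Longrightarrow> b \<in> V \<Longrightarrow> (M \<gamma> b \<noteq> 0 \<longleftrightarrow> b = \<delta>) \<and> (M b \<gamma> \<noteq> 0 \<longleftrightarrow> b = \<delta>)"
  shows "card (left_kernel V M) = card (left_kernel (V - fst ` T - snd ` T) M)"
  using assms
proof (induction T arbitrary: V rule: finite_induct)
  case (insert p T)
  obtain \<gamma> \<delta> where p: "p = (\<gamma>, \<delta>)" by force
  let ?W = "V - {\<gamma>, \<delta>}"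
  have in_V: "\<gamma> \<in> V" "\<delta> \<in> V" using insert.prems(2) p by auto
  have ne: "\<gamma> \<noteq> \<delta>" using insert.prems(5) p by auto
  have notin: "a \<noteq> \<gamma> \<and> a \<noteq> \<delta> \<and> b \<noteq> \<gamma> \<and> b \<noteq> \<delta>" if "(a, b) \<in> T" for a b
  proof -
    have "a \<noteq> \<gamma>" using inj_onD[OF insert.prems(3), of "(a, b)" p] that insert.hyps(2) p by auto
    moreover have "b \<noteq> \<delta>" using inj_onD[OF insert.prems(4), of "(a, b)" p] that insert.hyps(2) p by auto
    moreover have "a \<noteq> \<delta>" "b \<noteq> \<gamma>" using insert.prems(5) that p by force+
    ultimately show ?thesis by simp
  qed
  have "card (left_kernel V M) = card (left_kernel ?W M)"
    using insert.prems(6)[of \<gamma> \<delta>] p in_V ne insert.prems(1)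
    by (intro card_left_kernel_eliminate) auto
  also have "\<dots> = card (left_kernel (?W - fst ` T - snd ` T) M)"
  proof (rule insert.IH)
    show "finite ?W" using insert.prems(1) by simp
    show "T \<subseteq> ?W \<times> ?W"
    proof
      fix q assume "q \<in> T"
      then show "q \<in> ?W \<times> ?W" using notin[of "fst q" "snd q"] insert.prems(2) by (cases q) auto
    qed
    show "inj_on fst T" "inj_on snd T" "fst ` T \<inter> snd ` T = {}"
      using insert.prems(3-5) by (auto intro: inj_on_subset)
    show "(M a b \<noteq> 0 \<longleftrightarrow> b = c) \<and> (M b a \<noteq> 0 \<longleftrightarrow> b = c)" if "(a, c) \<in> T" "b \<in> ?W" for a c b
      using insert.prems(6)[of a c b] that by auto
  qed
  also have "?W - fst ` T - snd ` T = V - fst ` insert p T - snd ` insert p T"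
    by (auto simp: p)
  finally show ?case .
qed simp

section \<open>The invariant of the battleship steps\<close>

abbreviation (input) marked :: "mark \<Rightarrow> bool" where
  "marked x \<equiv> x \<in> {Plus_mark, Minus_mark}"

lemma admissible_pairs_iff:
  assumes "\<beta> \<in> pos_roots \<Phi> n"
  shows "(\<gamma>, \<delta>) \<in> admissible_pairs \<Phi> n \<beta> F \<longleftrightarrow> \<gamma> \<in> pos_roots \<Phi> n \<and> \<delta> \<in> pos_roots \<Phi> n \<and>
    splits \<gamma> \<delta> \<beta> \<and> F \<gamma> \<noteq> Minus_mark \<and> F \<delta> \<noteq> Minus_mark" (is "_ \<longleftrightarrow> ?R")
proof
  assume *: "(\<gamma>, \<delta>) \<in> admissible_pairs \<Phi> n \<beta> F"
  then have pos: "\<gamma> \<in> pos_roots \<Phi> n" "\<delta> \<in> pos_roots \<Phi> n" and col: "root_col \<gamma> = root_col \<beta>"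
    and "root_vec n \<gamma> + root_vec n \<delta> = root_vec n \<beta>"
    by (auto simp: admissible_pairs_def singular_plus_def singular_minus_def singular_def)
  then have "splits \<gamma> \<delta> \<beta> \<or> splits \<delta> \<gamma> \<beta>" using root_vec_add_iff_splits assms by blast
  moreover have "\<not> splits \<delta> \<gamma> \<beta>" using splits_col[of \<delta> \<gamma> \<beta>] pos col assms by fastforce
  ultimately show ?R using * pos by (auto simp: admissible_pairs_def)
next
  assume *: ?R
  then have sum: "root_vec n \<gamma> + root_vec n \<delta> = root_vec n \<beta>"
    using root_vec_add_iff_splits assms by blast
  then have sum': "root_vec n \<delta> + root_vec n \<gamma> = root_vec n \<beta>"
    using root_vec_add_iff_splits assms * by blast
  have "root_col \<gamma> = root_col \<beta>" "root_col \<beta> < root_col \<delta>"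
    using splits_col[of \<gamma> \<delta> \<beta>] * assms by fastforce+
  then show "(\<gamma>, \<delta>) \<in> admissible_pairs \<Phi> n \<beta> F"
    using * sum sum' by (auto simp: admissible_pairs_def singular_plus_def singular_minus_def singular_def)
qed

definition unmarked :: "root_type \<Rightarrow> nat \<Rightarrow> (root \<Rightarrow> mark) \<Rightarrow> root set" where
  "unmarked \<Phi> n F = {\<alpha> \<in> pos_roots \<Phi> n. \<not> marked (F \<alpha>)}"

text \<open>Here B is the set of roots of D already treated. The rule of a step excludes only roots
  marked minus, whereas the elimination requires pairs with no mark at all. The first clause closes
  this gap: earlier pluses lie in treated columns, and an admissible pair lies in the current column
  and a later one. The second clause says that treated roots contribute no matrix entry between
  unmarked roots.\<close>

definition battle_inv :: "root_type \<Rightarrow> nat \<Rightarrow> root set \<Rightarrow> (root \<Rightarrow> mark) \<Rightarrow> bool" where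
  "battle_inv \<Phi> n B F \<longleftrightarrow> (\<forall>\<alpha>. F \<alpha> = Plus_mark \<longrightarrow> root_col \<alpha> \<in> root_col ` B) \<and>
     (\<forall>\<beta>\<in>B. \<forall>\<gamma>\<in>pos_roots \<Phi> n. \<forall>\<delta>\<in>pos_roots \<Phi> n.
        splits \<gamma> \<delta> \<beta> \<longrightarrow> marked (F \<gamma>) \<or> marked (F \<delta>))"

text \<open>The uniqueness of the partner \<delta> is a matter of columns. Let \<gamma> + b =
  \<beta>' be in D with b unmarked. If \<gamma> lies in the column of \<beta>', then \<beta>' =
  \<beta>, as D has one root per column, and b = \<delta>. Otherwise the column of \<beta>' is
  smaller than that of \<gamma>, so \<beta>' has been treated and the invariant provides a mark on
  \<gamma> or b, a contradiction.\<close>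

lemma battleship_step_inv:
  fixes M :: "root \<Rightarrow> root \<Rightarrow> 'a::field"
  assumes inv: "battle_inv \<Phi> n B F"
    and D: "D \<subseteq> pos_roots \<Phi> n" "inj_on root_col D" and \<beta>: "\<beta> \<in> D"
    and less: "\<And>\<beta>'. \<beta>' \<in> B \<Longrightarrow> root_col \<beta>' < root_col \<beta>"
    and B: "\<And>\<beta>'. \<beta>' \<in> D \<Longrightarrow> root_col \<beta>' < root_col \<beta> \<Longrightarrow> \<beta>' \<in> B"
    and M: "\<And>\<alpha> \<gamma>. \<alpha> \<in> pos_roots \<Phi> n \<Longrightarrow> \<gamma> \<in> pos_roots \<Phi> n \<Longrightarrow>
      M \<alpha> \<gamma> \<noteq> 0 \<longleftrightarrow> (\<exists>\<beta>\<in>D. splits \<alpha> \<gamma> \<beta> \<or> splits \<gamma> \<alpha> \<beta>)"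
  shows "battle_inv \<Phi> n (insert \<beta> B) (battleship_step \<Phi> n \<beta> F)"
    and "card (left_kernel (unmarked \<Phi> n F) M) = card (left_kernel (unmarked \<Phi> n (battleship_step \<Phi> n \<beta> F)) M)"
proof -
  let ?P = "pos_roots \<Phi> n" and ?T = "admissible_pairs \<Phi> n \<beta> F" and ?F = "battleship_step \<Phi> n \<beta> F"
  have \<beta>P: "\<beta> \<in> ?P" using \<beta> D by blast
  note T_iff = admissible_pairs_iff[OF \<beta>P]
  have plus: "root_col \<alpha> < root_col \<beta>" if "F \<alpha> = Plus_mark" for \<alpha>
    using inv less that unfolding battle_inv_def by fastforce
  have col: "root_col \<gamma> = root_col \<beta>" "root_col \<beta> < root_col \<delta>" if "(\<gamma>, \<delta>) \<in> ?T" for \<gamma> \<delta>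
    using that splits_col[of \<gamma> \<delta> \<beta>] \<beta>P by (fastforce simp: T_iff)+
  have TU: "\<gamma> \<in> unmarked \<Phi> n F \<and> \<delta> \<in> unmarked \<Phi> n F" if "(\<gamma>, \<delta>) \<in> ?T" for \<gamma> \<delta>
    using that col[OF that] plus[of \<gamma>] plus[of \<delta>] by (auto simp: T_iff unmarked_def)
  have mono: "marked (?F \<alpha>)" if "marked (F \<alpha>)" for \<alpha>
    using that by (auto simp: battleship_step_def)
  show "battle_inv \<Phi> n (insert \<beta> B) ?F"
    unfolding battle_inv_def
  proof (intro conjI allI impI ballI)
    fix \<alpha> assume *: "?F \<alpha> = Plus_mark"
    show "root_col \<alpha> \<in> root_col ` insert \<beta> B"
    proof (cases "\<alpha> \<in> fst ` ?T")
      case True then show ?thesis using col by force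
    next
      case False
      then have "F \<alpha> = Plus_mark" using * by (auto simp: battleship_step_def split: if_splits)
      then show ?thesis using inv by (auto simp: battle_inv_def)
    qed
  next
    fix \<beta>' \<gamma> \<delta> assume *: "\<beta>' \<in> insert \<beta> B" "\<gamma> \<in> ?P" "\<delta> \<in> ?P" "splits \<gamma> \<delta> \<beta>'"
    show "marked (?F \<gamma>) \<or> marked (?F \<delta>)"
    proof (cases "\<beta>' = \<beta>")
      case True
      show ?thesis
      proof (cases "F \<gamma> = Minus_mark \<or> F \<delta> = Minus_mark")
        case True then show ?thesis using mono by blast
      next
        case False
        then have "(\<gamma>, \<delta>) \<in> ?T" using * \<open>\<beta>' = \<beta>\<close> T_iff by blast
        then have "\<gamma> \<in> fst ` ?T" by force
        then show ?thesis by (simp add: battleship_step_def)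
      qed
    next
      case False
      then have "marked (F \<gamma>) \<or> marked (F \<delta>)" using inv * unfolding battle_inv_def by blast
      then show ?thesis using mono by blast
    qed
  qed
  have "card (left_kernel (unmarked \<Phi> n F) M) = card (left_kernel (unmarked \<Phi> n F - fst ` ?T - snd ` ?T) M)"
  proof (rule card_left_kernel_eliminate_pairs)
    show fin: "finite (unmarked \<Phi> n F)" by (simp add: unmarked_def)
    show sub: "?T \<subseteq> unmarked \<Phi> n F \<times> unmarked \<Phi> n F" using TU by auto
    show "finite ?T" using finite_subset[OF sub] fin by simp
    show "inj_on fst ?T"
      using splits_unique(1)[of _ \<Phi> n] T_iff by (intro inj_onI) (metis prod.collapse)
    show "inj_on snd ?T"
      using splits_unique(2)[of _ \<Phi> n] T_iff by (intro inj_onI) (metis prod.collapse)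
    show "fst ` ?T \<inter> snd ` ?T = {}" using col by fastforce
    fix \<gamma> \<delta> b assume T: "(\<gamma>, \<delta>) \<in> ?T" and b: "b \<in> unmarked \<Phi> n F"
    have P: "\<gamma> \<in> ?P" "\<delta> \<in> ?P" "b \<in> ?P" "splits \<gamma> \<delta> \<beta>" using T b T_iff by (auto simp: unmarked_def)
    have "(\<exists>\<beta>\<in>D. splits \<gamma> b \<beta> \<or> splits b \<gamma> \<beta>) \<longleftrightarrow> b = \<delta>"
    proof
      assume "\<exists>\<beta>\<in>D. splits \<gamma> b \<beta> \<or> splits b \<gamma> \<beta>"
      then obtain \<beta>' where \<beta>': "\<beta>' \<in> D" "splits \<gamma> b \<beta>' \<or> splits b \<gamma> \<beta>'" by blast
      have \<beta>'P: "\<beta>' \<in> ?P" using \<beta>' D by blast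
    have "\<not> splits b \<gamma> \<beta>'"
      proof
        assume s: "splits b \<gamma> \<beta>'"
        then have "root_col \<beta>' < root_col \<beta>" using splits_col[OF s] P \<beta>'P col[OF T] by fastforce
        then have "\<beta>' \<in> B" using B \<beta>' by blast
        then have "marked (F b) \<or> marked (F \<gamma>)" using inv s P unfolding battle_inv_def by blast
        then show False using b TU[OF T] unfolding unmarked_def by blast
      qed
      then have s: "splits \<gamma> b \<beta>'" using \<beta>' by blast
      then have "root_col \<beta>' = root_col \<beta>" using splits_col[OF s] P \<beta>'P col[OF T] by simp
      then have "\<beta>' = \<beta>" using D \<beta> \<beta>' by (simp add: inj_on_eq_iff)
      then show "b = \<delta>" using s P splits_unique(1) by blast
    qed (use P \<beta> in blast)
    then show "(M \<gamma> b \<noteq> 0 \<longleftrightarrow> b = \<delta>) \<and> (M b \<gamma> \<noteq> 0 \<longleftrightarrow> b = \<delta>)"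
      using M P by blast
  qed
  also have "unmarked \<Phi> n F - fst ` ?T - snd ` ?T = unmarked \<Phi> n ?F"
    by (auto simp: unmarked_def battleship_step_def)
  finally show "card (left_kernel (unmarked \<Phi> n F) M) = card (left_kernel (unmarked \<Phi> n ?F) M)" .
qed

lemma (in linorder) strict_sorted_key_list_of_set_inj:
  assumes "inj_on f A" "finite A"
  shows "set (sorted_key_list_of_set f A) = A" "sorted_wrt (<) (map f (sorted_key_list_of_set f A))"
proof -
  interpret folding_insort_key "(\<le>)" "(<)" A f
    by unfold_locales (rule assms(1))
  show "set (sorted_key_list_of_set f A) = A" "sorted_wrt (<) (map f (sorted_key_list_of_set f A))"
    using assms(2) by simp_all
qed

lemma card_left_kernel_battleship:
  fixes M :: "root \<Rightarrow> root \<Rightarrow> 'a::{field,finite}"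
  assumes D: "D \<subseteq> pos_roots \<Phi> n" "inj_on root_col D"
    and M: "\<And>\<alpha> \<gamma>. \<alpha> \<in> pos_roots \<Phi> n \<Longrightarrow> \<gamma> \<in> pos_roots \<Phi> n \<Longrightarrow>
      M \<alpha> \<gamma> \<noteq> 0 \<longleftrightarrow> (\<exists>\<beta>\<in>D. splits \<alpha> \<gamma> \<beta> \<or> splits \<gamma> \<alpha> \<beta>)"
  shows "card (left_kernel (pos_roots \<Phi> n) M) = CARD('a) ^ card (unmarked \<Phi> n (battleship \<Phi> n D))"
proof -
  let ?L = "sorted_key_list_of_set root_col D"
  let ?F0 = "\<lambda>\<alpha>. if \<alpha> \<in> D then Rook_mark else Bullet_mark"
  have finD: "finite D" using finite_subset[OF D(1)] by simp
  note L = strict_sorted_key_list_of_set_inj[OF D(2) finD]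
  \<comment> \<open>The induction runs over prefixes of the sorted list, so that at each step every
    root of D in a smaller column is known to have been treated.\<close>
  have "battle_inv \<Phi> n (set xs) (fold (battleship_step \<Phi> n) xs ?F0) \<and>
      card (left_kernel (unmarked \<Phi> n (fold (battleship_step \<Phi> n) xs ?F0)) M) = card (left_kernel (pos_roots \<Phi> n) M)"
    if "?L = xs @ ys" for xs ys
    using that
  proof (induction xs arbitrary: ys rule: rev_induct)
    case Nil
    have "unmarked \<Phi> n ?F0 = pos_roots \<Phi> n" by (auto simp: unmarked_def)
    then show ?case by (simp add: battle_inv_def)
  next
    case (snoc \<beta> xs)
    let ?F = "fold (battleship_step \<Phi> n) xs ?F0"
    have L': "?L = xs @ \<beta> # ys" using snoc.prems by simp
    note IH = snoc.IH[OF L']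
    have \<beta>: "\<beta> \<in> D" using L(1) L' by auto
    have less: "\<And>\<beta>'. \<beta>' \<in> set xs \<Longrightarrow> root_col \<beta>' < root_col \<beta>"
      and greater: "\<And>\<beta>'. \<beta>' \<in> set ys \<Longrightarrow> root_col \<beta> < root_col \<beta>'"
      using L(2) unfolding L' by (auto simp: sorted_wrt_append)
    have B: "\<beta>' \<in> set xs" if "\<beta>' \<in> D" "root_col \<beta>' < root_col \<beta>" for \<beta>'
    proof -
      have "\<beta>' \<in> set xs \<or> \<beta>' = \<beta> \<or> \<beta>' \<in> set ys" using that(1) L(1) L' by auto
      then show ?thesis using that(2) greater by fastforce
    qed
    show ?case
      using battleship_step_inv[of \<Phi> n "set xs" ?F D \<beta> M, OF _ D \<beta> less B M] IH by simp
  qed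
  from this[of ?L "[]"]
  have inv: "battle_inv \<Phi> n D (battleship \<Phi> n D)"
    and card: "card (left_kernel (unmarked \<Phi> n (battleship \<Phi> n D)) M) = card (left_kernel (pos_roots \<Phi> n) M)"
    by (simp_all add: L battleship_def)
  let ?U = "unmarked \<Phi> n (battleship \<Phi> n D)"
  have "M \<alpha> \<gamma> = 0" if "\<alpha> \<in> ?U" "\<gamma> \<in> ?U" for \<alpha> \<gamma>
  proof (rule ccontr)
    have P: "\<alpha> \<in> pos_roots \<Phi> n" "\<gamma> \<in> pos_roots \<Phi> n" using that by (auto simp: unmarked_def)
    assume "M \<alpha> \<gamma> \<noteq> 0"
    then obtain \<beta> where "\<beta> \<in> D" "splits \<alpha> \<gamma> \<beta> \<or> splits \<gamma> \<alpha> \<beta>" using M[OF P] by blast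
    then have "marked (battleship \<Phi> n D \<alpha>) \<or> marked (battleship \<Phi> n D \<gamma>)"
      using inv P unfolding battle_inv_def by blast
    then show False using that unfolding unmarked_def by blast
  qed
  then have "left_kernel ?U M = ?U \<rightarrow>\<^sub>E (UNIV :: 'a set)" by (simp add: left_kernel_def)
  moreover have "finite ?U" by (simp add: unmarked_def)
  ultimately have "card (left_kernel ?U M) = CARD('a) ^ card ?U" by (simp add: card_PiE)
  then show ?thesis using card by simp
qed

section \<open>The Lie algebra inside the incidence algebra\<close>

definition block :: "nat \<Rightarrow> 'a::zero inc \<Rightarrow> 'a mat" where
  "block m x = mat m m (\<lambda>(r, s). entry x (int r) (int s))"

lemma block_index [simp]: "r < m \<Longrightarrow> s < m \<Longrightarrow> block m x $$ (r, s) = entry x (int r) (int s)"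
  by (simp add: block_def)

lemma block_carrier [simp]: "block m x \<in> carrier_mat m m" "dim_row (block m x) = m" "dim_col (block m x) = m"
  by (simp_all add: block_def)

lemma block_add: "block m (x + y) = block m x + block m (y :: 'a::ring_1 inc)"
  by (rule eq_matI) auto

lemma block_diff: "block m (x - y) = block m x - block m (y :: 'a::ring_1 inc)"
  by (rule eq_matI) auto

lemma block_scal: "block m (scal c * x) = c \<cdot>\<^sub>m block m (x :: 'a::ring_1 inc)"
  by (rule eq_matI) auto

lemma block_one: "block m (1 :: 'a::ring_1 inc) = 1\<^sub>m m"
  by (rule eq_matI) auto

text \<open>Cutting out a block respects products because the indices summed over lie between the
  column and the row of the entry, hence in the block.\<close>

lemma block_mult: "block m (x * y) = block m x * block m (y :: 'a::ring_1 inc)"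
proof (rule eq_matI)
  fix r s assume "r < dim_row (block m x * block m y)" "s < dim_col (block m x * block m y)"
  then have rs: "r < m" "s < m" by simp_all
  have "(\<Sum>k\<in>{int s..int r}. entry x (int r) k * entry y k (int s)) =
      (\<Sum>k\<in>{0..<int m}. entry x (int r) k * entry y k (int s))"
    using rs by (intro sum.mono_neutral_left) auto
  also have "\<dots> = (\<Sum>k\<in>{0..<m}. entry x (int r) (int k) * entry y (int k) (int s))"
    by (rule sum.reindex_bij_witness[of _ int nat]) auto
  finally show "block m (x * y) $$ (r, s) = (block m x * block m y) $$ (r, s)"
    using rs by (simp add: entry_mult scalar_prod_def)
qed simp_all

lemma block_power: "block m (x ^ k) = block m (x :: 'a::ring_1 inc) ^\<^sub>m k"
  by (induction k) (simp_all add: block_one block_mult power_Suc2 del: power_Suc)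

lemma block_expm: "block m (expm m x) = trunc_exp m (block m x)"
proof (rule eq_matI)
  fix r s assume "r < dim_row (trunc_exp m (block m x))" "s < dim_col (trunc_exp m (block m x))"
  then have rs: "r < m" "s < m" by (simp_all add: trunc_exp_def)
  then show "block m (expm m x) $$ (r, s) = trunc_exp m (block m x) $$ (r, s)"
    by (simp add: trunc_exp_def expm_def block_power[symmetric])
qed (simp_all add: trunc_exp_def)

lemma mat_inverse_eqI:
  fixes A B :: "'a::field mat"
  assumes A: "A \<in> carrier_mat n n" and B: "B \<in> carrier_mat n n"
    and AB: "A * B = 1\<^sub>m n" and BA: "B * A = 1\<^sub>m n"
  shows "mat_inverse A = Some B"
proof (cases "mat_inverse A")
  case None
  have "A \<in> Units (ring_mat TYPE('a) n ())"
    using assms by (auto simp: Units_def ring_mat_simps)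
  then show ?thesis using mat_inverse(1)[OF A None, of "()"] by blast
next
  case (Some C)
  then have C: "A * C = 1\<^sub>m n" "C \<in> carrier_mat n n" using mat_inverse(2)[OF A] by auto
  have "C = (B * A) * C" using BA C by simp
  also have "\<dots> = B * (A * C)" using A B C by (simp add: assoc_mult_mat)
  also have "\<dots> = B" using B C by simp
  finally show ?thesis using Some by simp
qed

section \<open>Matrix units, positions of indices and the root basis\<close>

lift_definition eunit :: "int \<Rightarrow> int \<Rightarrow> 'a::ring_1 inc"
  is "\<lambda>a b r s. if r = a \<and> s = b \<and> b \<le> a then 1 else 0" by simp

lemma entry_eunit [simp]: "entry (eunit a b) r s = (if r = a \<and> s = b \<and> b \<le> a then 1 else 0)"
  by transfer simp

lemma eunit_mult:
  assumes "b \<le> a" "d \<le> c"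
  shows "eunit a b * eunit c d = (if b = c then eunit a d else 0 :: 'a::ring_1 inc)"
proof (rule inc_eqI)
  fix r s :: int assume "s \<le> r"
  have "entry (eunit a b * eunit c d :: 'a inc) r s =
      (\<Sum>k\<in>{s..r}. if k = b then (if r = a \<and> b = c \<and> s = d then 1 else 0) else 0)"
    unfolding entry_mult using assms by (intro sum.cong) auto
  also have "\<dots> = entry (if b = c then eunit a d else 0) r s" using assms by auto
  finally show "entry (eunit a b * eunit c d :: 'a inc) r s = entry (if b = c then eunit a d else 0) r s" .
qed

lemma star_eunit: "star c (eunit a b) = eunit (c - b) (c - a)"
  by (rule inc_eqI) auto

definition idx :: "root_type \<Rightarrow> nat \<Rightarrow> int set" where
  "idx \<Phi> n = {a. \<bar>a\<bar> \<le> int n \<and> (a = 0 \<longrightarrow> \<Phi> = Type_B)}"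

abbreviation pidx :: "root_type \<Rightarrow> nat \<Rightarrow> int \<Rightarrow> int" where
  "pidx \<Phi> n a \<equiv> int (pos_of \<Phi> n a)"

lemma pidx_eq:
  "a \<in> idx \<Phi> n \<Longrightarrow> pidx \<Phi> n a =
    (if a > 0 then a - 1 else if a = 0 then int n else int (mat_size \<Phi> n) + a)"
  by (cases \<Phi>) (auto simp: pos_of_def idx_def mat_size_def)

lemma pidx_bounds: "a \<in> idx \<Phi> n \<Longrightarrow> pos_of \<Phi> n a < mat_size \<Phi> n"
  by (cases \<Phi>) (auto simp: pos_of_def idx_def mat_size_def)

text \<open>Negating an index reflects its position at the centre of the list. This is why the two
  matrix units of a root element are exchanged by \<open>star\<close>.\<close>

lemma pidx_uminus: "a \<in> idx \<Phi> n \<Longrightarrow> pidx \<Phi> n (- a) = int (mat_size \<Phi> n) - 1 - pidx \<Phi> n a"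
  by (cases \<Phi>) (auto simp: pos_of_def idx_def mat_size_def)

lemma pidx_inj: "a \<in> idx \<Phi> n \<Longrightarrow> b \<in> idx \<Phi> n \<Longrightarrow> pos_of \<Phi> n a = pos_of \<Phi> n b \<longleftrightarrow> a = b"
  by (cases \<Phi>) (auto simp: pos_of_def idx_def mat_size_def split: if_splits)

lemma idx_uminus: "a \<in> idx \<Phi> n \<Longrightarrow> - a \<in> idx \<Phi> n"
  by (auto simp: idx_def)

lemma root_idx:
  assumes "\<alpha> \<in> pos_roots \<Phi> n"
  shows "root_row \<alpha> \<in> idx \<Phi> n" "int (root_col \<alpha>) \<in> idx \<Phi> n"
  using assms by (cases \<alpha>; auto simp: idx_def)+

text \<open>Together with \<open>root_at\<close>: the positions given by row and column of the roots
  fill the triangle between the diagonal and the antidiagonal on the side of the first column. Up to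
  the reflection these are all positions below the diagonal and off the antidiagonal.\<close>

lemma root_pos:
  assumes "\<alpha> \<in> pos_roots \<Phi> n"
  shows "pidx \<Phi> n (int (root_col \<alpha>)) < pidx \<Phi> n (root_row \<alpha>)"
    "pidx \<Phi> n (int (root_col \<alpha>)) + pidx \<Phi> n (root_row \<alpha>) < int (mat_size \<Phi> n) - 1"
  unfolding pidx_eq[OF root_idx(1)[OF assms]] pidx_eq[OF root_idx(2)[OF assms]]
  using assms by (cases \<alpha>; cases \<Phi>; auto simp: mat_size_def)+

lemma root_eqI:
  assumes "\<alpha> \<in> pos_roots \<Phi> n" "\<gamma> \<in> pos_roots \<Phi> n" "root_row \<alpha> = root_row \<gamma>" "root_col \<alpha> = root_col \<gamma>"
  shows "\<alpha> = \<gamma>"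
  using assms by (cases \<alpha>; cases \<gamma>) auto

lemma root_at:
  assumes "0 \<le> s" "s < r" "r + s < int (mat_size \<Phi> n) - 1"
  obtains \<alpha> where "\<alpha> \<in> pos_roots \<Phi> n" "pidx \<Phi> n (root_row \<alpha>) = r" "pidx \<Phi> n (int (root_col \<alpha>)) = s"
proof -
  let ?m = "int (mat_size \<Phi> n)"
  define i where "i = nat (s + 1)"
  have i: "int i = s + 1" "1 \<le> i" using assms by (auto simp: i_def)
  have m: "?m = 2 * int n + (if \<Phi> = Type_B then 1 else 0)"
    by (cases \<Phi>) (auto simp: mat_size_def)
  \<comment> \<open>Rows of positive, zero and negative index. The index 0 sits at position n and
    exists in type B only.\<close>
  consider "r < int n" | "r = int n" "\<Phi> = Type_B" | "?m - int n \<le> r"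
    using m by (cases \<Phi>) force+
  then show thesis
  proof cases
    case 1
    have "i < nat (r + 1)" "nat (r + 1) \<le> n" using 1 i assms by linarith+
    then show thesis
      using that[of "Diff i (nat (r + 1))"] 1 i assms by (simp add: pos_of_def)
  next
    case 2
    show thesis using that[of "Short i"] 2 i assms m by (simp add: pos_of_def)
  next
    case 3
    have j: "i < nat (?m - r)" "nat (?m - r) \<le> n" "int (nat (?m - r)) = ?m - r"
      using 3 i assms by linarith+
    show thesis
      using that[of "Add i (nat (?m - r))"] j i assms by (simp add: pos_of_def)
  qed
qed

text \<open>One formula serves the three kinds of roots: row and column are the indices of the first
  matrix unit, and the second unit is its reflection.\<close>

definition root_inc :: "root_type \<Rightarrow> nat \<Rightarrow> root \<Rightarrow> 'a::ring_1 inc" where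
  "root_inc \<Phi> n \<alpha> = eunit (pidx \<Phi> n (root_row \<alpha>)) (pidx \<Phi> n (int (root_col \<alpha>)))
     - eunit (pidx \<Phi> n (- int (root_col \<alpha>))) (pidx \<Phi> n (- root_row \<alpha>))"

lemma root_inc_skews:
  assumes "\<alpha> \<in> pos_roots \<Phi> n"
  shows "root_inc \<Phi> n \<alpha> \<in> skews (mat_size \<Phi> n)"
proof -
  have "star (int (mat_size \<Phi> n) - 1) (root_inc \<Phi> n \<alpha>) = - root_inc \<Phi> n \<alpha>"
    using root_idx[OF assms] by (simp add: root_inc_def star_eunit pidx_uminus)
  moreover have "root_inc \<Phi> n \<alpha> \<in> strict (mat_size \<Phi> n)"
    using root_idx[OF assms] root_pos[OF assms] pidx_bounds[of _ \<Phi> n]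
    by (auto simp: root_inc_def strict_def level_def in_block_def pidx_uminus)
  ultimately show ?thesis by (simp add: skews_def)
qed

lemma entry_root_inc:
  assumes "\<alpha> \<in> pos_roots \<Phi> n" "\<gamma> \<in> pos_roots \<Phi> n"
  shows "entry (root_inc \<Phi> n \<gamma>) (pidx \<Phi> n (root_row \<alpha>)) (pidx \<Phi> n (int (root_col \<alpha>))) = (if \<gamma> = \<alpha> then 1 else 0)"
  using root_idx[OF assms(1)] root_idx[OF assms(2)] root_pos[OF assms(1)] root_pos[OF assms(2)]
    root_eqI[OF assms]
  by (auto simp: root_inc_def pidx_uminus pidx_inj)

text \<open>Skewness transports the entries from one side of the antidiagonal to the other. On the
  antidiagonal an entry equals its own negative and vanishes, since 2 is invertible.\<close>

lemma skews_eqI: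
  fixes x y :: "'a::field inc"
  assumes two: "(2 :: 'a) \<noteq> 0" and x: "x \<in> skews (mat_size \<Phi> n)" and y: "y \<in> skews (mat_size \<Phi> n)"
    and eq: "\<And>\<alpha>. \<alpha> \<in> pos_roots \<Phi> n \<Longrightarrow> entry x (pidx \<Phi> n (root_row \<alpha>)) (pidx \<Phi> n (int (root_col \<alpha>)))
      = entry y (pidx \<Phi> n (root_row \<alpha>)) (pidx \<Phi> n (int (root_col \<alpha>)))"
  shows "x = y"
proof (rule inc_eqI)
  fix r s :: int assume "s \<le> r"
  let ?m = "int (mat_size \<Phi> n)"
  have anti: "entry z (?m - 1 - s) (?m - 1 - r) = - entry z r s"
    if "z \<in> skews (mat_size \<Phi> n)" for z :: "'a inc" and r s
  proof -
    have "entry (star (?m - 1) z) r s = - entry z r s" using that by (simp add: skews_def del: entry_star)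
    then show ?thesis by simp
  qed
  have low: "entry x r s = entry y r s" if "0 \<le> s" "s < r" "r + s < ?m - 1" for r s
    using root_at[OF that] eq by metis
  show "entry x r s = entry y r s"
  proof (cases "0 \<le> s \<and> s < r \<and> r < ?m")
    case False
    then have "entry x r s = 0" "entry y r s = 0"
      using x y by (auto simp: skews_def strict_def level_def in_block_def)
    then show ?thesis by simp
  next
    case True
    consider "r + s < ?m - 1" | "r + s = ?m - 1" | "r + s > ?m - 1" by linarith
    then show ?thesis
    proof cases
      case 1 then show ?thesis using low True by simp
    next
      case 2
      have "entry z r s = 0" if "z \<in> skews (mat_size \<Phi> n)" for z :: "'a inc"
      proof -
        have e: "?m - 1 - s = r" "?m - 1 - r = s" using 2 by linarith+
        have "entry z r s = - entry z r s" using anti[OF that, of s r] unfolding e .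
        then have "2 * entry z r s = 0" by (simp only: mult_2 eq_neg_iff_add_eq_0)
        then show ?thesis using two by simp
      qed
      then show ?thesis using x y by simp
    next
      case 3
      then have "entry x (?m - 1 - s) (?m - 1 - r) = entry y (?m - 1 - s) (?m - 1 - r)"
        using True by (intro low) auto
      then show ?thesis using anti[OF x] anti[OF y] by simp
    qed
  qed
qed

definition comb :: "root_type \<Rightarrow> nat \<Rightarrow> (root \<Rightarrow> 'a) \<Rightarrow> 'a::ring_1 inc" where
  "comb \<Phi> n c = (\<Sum>\<alpha>\<in>pos_roots \<Phi> n. scal (c \<alpha>) * root_inc \<Phi> n \<alpha>)"

lemma skews_closed:
  fixes x y :: "'a::comm_ring_1 inc"
  shows "0 \<in> skews m" "x \<in> skews m \<Longrightarrow> y \<in> skews m \<Longrightarrow> x + y \<in> skews m"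
    "x \<in> skews m \<Longrightarrow> scal c * x \<in> skews m"
  by (auto simp: skews_def scal_commute)

lemma comb_skews: "comb \<Phi> n c \<in> skews (mat_size \<Phi> n)" for c :: "root \<Rightarrow> 'a::comm_ring_1"
proof -
  have "(\<Sum>\<alpha>\<in>A. scal (c \<alpha>) * root_inc \<Phi> n \<alpha>) \<in> skews (mat_size \<Phi> n)" if "A \<subseteq> pos_roots \<Phi> n" for A
    using finite_subset[OF that finite_pos_roots] that
    by (induction A rule: finite_induct) (auto intro!: skews_closed root_inc_skews)
  then show ?thesis by (simp add: comb_def)
qed

lemma entry_comb:
  assumes "\<alpha> \<in> pos_roots \<Phi> n"
  shows "entry (comb \<Phi> n c) (pidx \<Phi> n (root_row \<alpha>)) (pidx \<Phi> n (int (root_col \<alpha>))) = c \<alpha>"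
proof -
  have "entry (comb \<Phi> n c) (pidx \<Phi> n (root_row \<alpha>)) (pidx \<Phi> n (int (root_col \<alpha>))) =
      (\<Sum>\<gamma>\<in>pos_roots \<Phi> n. if \<gamma> = \<alpha> then c \<gamma> else 0)"
    unfolding comb_def entry_sum entry_scal_mult using entry_root_inc[OF assms, where 'a = 'a]
    by (intro sum.cong) auto
  then show ?thesis using assms by simp
qed

lemma bij_betw_comb:
  assumes "(2 :: 'a::field) \<noteq> 0"
  shows "bij_betw (comb \<Phi> n) (pos_roots \<Phi> n \<rightarrow>\<^sub>E (UNIV :: 'a set)) (skews (mat_size \<Phi> n))"
proof (rule bij_betw_imageI)
  show "inj_on (comb \<Phi> n) (pos_roots \<Phi> n \<rightarrow>\<^sub>E (UNIV :: 'a set))"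
  proof (rule inj_onI)
    fix c d :: "root \<Rightarrow> 'a"
    assume c: "c \<in> pos_roots \<Phi> n \<rightarrow>\<^sub>E UNIV" "d \<in> pos_roots \<Phi> n \<rightarrow>\<^sub>E UNIV"
      and eq: "comb \<Phi> n c = comb \<Phi> n d"
    have "c \<alpha> = d \<alpha>" if "\<alpha> \<in> pos_roots \<Phi> n" for \<alpha>
      using entry_comb[OF that, of c] entry_comb[OF that, of d] eq by simp
    then show "c = d" using c by (intro PiE_ext)
  qed
  show "comb \<Phi> n ` (pos_roots \<Phi> n \<rightarrow>\<^sub>E (UNIV :: 'a set)) = skews (mat_size \<Phi> n)"
  proof (intro equalityI subsetI)
    fix x :: "'a inc" assume x: "x \<in> skews (mat_size \<Phi> n)"
    let ?c = "\<lambda>\<alpha>\<in>pos_roots \<Phi> n. entry x (pidx \<Phi> n (root_row \<alpha>)) (pidx \<Phi> n (int (root_col \<alpha>)))"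
    have c: "x = comb \<Phi> n ?c"
      by (rule sym, rule skews_eqI[OF assms comb_skews x]) (simp add: entry_comb)
    show "x \<in> comb \<Phi> n ` (pos_roots \<Phi> n \<rightarrow>\<^sub>E UNIV)"
      by (rule image_eqI[where f = "comb \<Phi> n", OF c]) simp
  qed (auto simp: comb_skews)
qed

lemma elem_mat_eq_block:
  assumes "a \<in> idx \<Phi> n" "b \<in> idx \<Phi> n" "pidx \<Phi> n b \<le> pidx \<Phi> n a"
  shows "elem_mat \<Phi> n a b = block (mat_size \<Phi> n) (eunit (pidx \<Phi> n a) (pidx \<Phi> n b))"
  using assms by (intro eq_matI) (auto simp: elem_mat_def block_def)

lemma root_mat_eq_elem_mat:
  "root_mat \<Phi> n \<alpha> = elem_mat \<Phi> n (root_row \<alpha>) (int (root_col \<alpha>))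
    - elem_mat \<Phi> n (- int (root_col \<alpha>)) (- root_row \<alpha>)"
  by (cases \<alpha>) simp_all

lemma root_mat_eq_block:
  assumes "\<alpha> \<in> pos_roots \<Phi> n"
  shows "root_mat \<Phi> n \<alpha> = block (mat_size \<Phi> n) (root_inc \<Phi> n \<alpha>)"
proof -
  note i = root_idx[OF assms]
  have "pidx \<Phi> n (- root_row \<alpha>) \<le> pidx \<Phi> n (- int (root_col \<alpha>))"
    using root_pos[OF assms] i by (simp add: pidx_uminus)
  then show ?thesis
    using root_pos[OF assms] i idx_uminus[OF i(1)] idx_uminus[OF i(2)]
    unfolding root_mat_eq_elem_mat root_inc_def block_diff by (simp add: elem_mat_eq_block)
qed

lemma root_comb_eq_block: "root_comb \<Phi> n c = block (mat_size \<Phi> n) (comb \<Phi> n c)"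
proof (rule eq_matI)
  let ?m = "mat_size \<Phi> n"
  fix r s assume "r < dim_row (block ?m (comb \<Phi> n c))" "s < dim_col (block ?m (comb \<Phi> n c))"
  then have rs: "r < ?m" "s < ?m" by simp_all
  have "(\<Sum>\<alpha>\<in>pos_roots \<Phi> n. c \<alpha> * root_mat \<Phi> n \<alpha> $$ (r, s)) =
      (\<Sum>\<alpha>\<in>pos_roots \<Phi> n. c \<alpha> * entry (root_inc \<Phi> n \<alpha>) (int r) (int s))"
    using rs by (intro sum.cong) (auto simp: root_mat_eq_block)
  then show "root_comb \<Phi> n c $$ (r, s) = block ?m (comb \<Phi> n c) $$ (r, s)"
    using rs by (simp add: root_comb_def comb_def)
qed (simp_all add: root_comb_def)

lemma lie_u_eq_block:
  assumes "(2 :: 'a::field) \<noteq> 0"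
  shows "lie_u \<Phi> n = block (mat_size \<Phi> n) ` (skews (mat_size \<Phi> n) :: 'a inc set)"
proof -
  have "range (comb \<Phi> n) = (skews (mat_size \<Phi> n) :: 'a inc set)"
  proof (intro equalityI subsetI)
    fix x :: "'a inc" assume "x \<in> skews (mat_size \<Phi> n)"
    then show "x \<in> range (comb \<Phi> n)" using bij_betw_comb[OF assms] unfolding bij_betw_def by blast
  qed (auto simp: comb_skews)
  moreover have "lie_u \<Phi> n = block (mat_size \<Phi> n) ` range (comb \<Phi> n :: _ \<Rightarrow> 'a inc)"
    unfolding lie_u_def root_comb_eq_block[abs_def] by (simp add: image_image)
  ultimately show ?thesis by simp
qed

section \<open>The matrix of the form\<close>

text \<open>A dual basis element reads off one entry. In this form the functional is defined on the
  whole ring and can be applied to a product of skew elements, which need not be skew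
  itself.\<close>

definition rook_functional :: "root_type \<Rightarrow> nat \<Rightarrow> root set \<Rightarrow> (root \<Rightarrow> 'a) \<Rightarrow> 'a::field inc \<Rightarrow> 'a" where
  "rook_functional \<Phi> n D \<xi> x =
     (\<Sum>\<beta>\<in>D. \<xi> \<beta> * entry x (pidx \<Phi> n (root_row \<beta>)) (pidx \<Phi> n (int (root_col \<beta>))))"

lemma rook_functional_linear:
  "rook_functional \<Phi> n D \<xi> (x + y) = rook_functional \<Phi> n D \<xi> x + rook_functional \<Phi> n D \<xi> y"
  "rook_functional \<Phi> n D \<xi> (scal c * x) = c * rook_functional \<Phi> n D \<xi> x"
  "rook_functional \<Phi> n D \<xi> (sum f A) = (\<Sum>a\<in>A. rook_functional \<Phi> n D \<xi> (f a))"
proof -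
  show add: "rook_functional \<Phi> n D \<xi> (x + y) = rook_functional \<Phi> n D \<xi> x + rook_functional \<Phi> n D \<xi> y" for x y
    by (simp add: rook_functional_def distrib_left sum.distrib)
  show "rook_functional \<Phi> n D \<xi> (scal c * x) = c * rook_functional \<Phi> n D \<xi> x"
    by (simp add: rook_functional_def sum_distrib_left mult.left_commute)
  show "rook_functional \<Phi> n D \<xi> (sum f A) = (\<Sum>a\<in>A. rook_functional \<Phi> n D \<xi> (f a))"
    by (induction A rule: infinite_finite_induct) (simp_all add: add, simp_all add: rook_functional_def)
qed

text \<open>The entry at the position of \<beta> of the product of the root elements of \<alpha> and
  \<gamma>. Of the four products of matrix units one always vanishes, as it would require a column
  index to be the negative of another; the other three give the three terms.\<close>

definition bracket_term :: "root \<Rightarrow> root \<Rightarrow> root \<Rightarrow> int" where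
  "bracket_term \<alpha> \<gamma> \<beta> =
     (if int (root_col \<alpha>) = root_row \<gamma> \<and> root_row \<alpha> = root_row \<beta> \<and> root_col \<gamma> = root_col \<beta> then 1 else 0)
   - (if root_row \<gamma> = - root_row \<alpha> \<and> root_row \<beta> = - int (root_col \<alpha>) \<and> root_col \<gamma> = root_col \<beta> then 1 else 0)
   + (if root_row \<alpha> = int (root_col \<gamma>) \<and> root_row \<beta> = - int (root_col \<alpha>) \<and>
        root_row \<gamma> = - int (root_col \<beta>) then 1 else 0)"

lemma entry_root_inc_mult:
  assumes \<alpha>: "\<alpha> \<in> pos_roots \<Phi> n" and \<gamma>: "\<gamma> \<in> pos_roots \<Phi> n" and \<beta>: "\<beta> \<in> pos_roots \<Phi> n"
  shows "entry (root_inc \<Phi> n \<alpha> * root_inc \<Phi> n \<gamma> :: 'a::field inc) (pidx \<Phi> n (root_row \<beta>)) (pidx \<Phi> n (int (root_col \<beta>)))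
    = of_int (bracket_term \<alpha> \<gamma> \<beta>)"
proof -
  let ?p = "pidx \<Phi> n" and ?ra = "root_row \<alpha>" and ?ca = "int (root_col \<alpha>)"
    and ?rc = "root_row \<gamma>" and ?cc = "int (root_col \<gamma>)"
    and ?rb = "root_row \<beta>" and ?cb = "int (root_col \<beta>)"
  note ia = root_idx[OF \<alpha>] and ic = root_idx[OF \<gamma>] and ib = root_idx[OF \<beta>]
  note na = ia[THEN idx_uminus] and nc = ic[THEN idx_uminus]
  have le: "?p ?ca \<le> ?p ?ra" "?p (- ?ra) \<le> ?p (- ?ca)" "?p ?cc \<le> ?p ?rc" "?p (- ?rc) \<le> ?p (- ?cc)"
    "?p ?cb \<le> ?p ?rb"
    using root_pos[OF \<alpha>] root_pos[OF \<gamma>] root_pos[OF \<beta>] ia ic by (simp_all add: pidx_uminus)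
  have pos: "0 < root_col \<alpha>" "0 < root_col \<gamma>" using \<alpha> \<gamma> by (cases \<alpha>; cases \<gamma>; simp)+
  have "root_inc \<Phi> n \<alpha> * root_inc \<Phi> n \<gamma> =
      (if ?ca = ?rc then eunit (?p ?ra) (?p ?cc) else 0)
    - (if - ?ra = ?rc then eunit (?p (- ?ca)) (?p ?cc) else 0)
    + (if ?ra = ?cc then eunit (?p (- ?ca)) (?p (- ?rc)) else (0 :: 'a inc))"
  proof -
    have "eunit (?p ?ra) (?p ?ca) * eunit (?p ?rc) (?p ?cc) =
        (if ?ca = ?rc then eunit (?p ?ra) (?p ?cc) else (0 :: 'a inc))"
      using eunit_mult[OF le(1,3)] pidx_inj[OF ia(2) ic(1)] by simp
    moreover have "eunit (?p (- ?ca)) (?p (- ?ra)) * eunit (?p ?rc) (?p ?cc) =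
        (if - ?ra = ?rc then eunit (?p (- ?ca)) (?p ?cc) else (0 :: 'a inc))"
      using eunit_mult[OF le(2,3)] pidx_inj[OF na(1) ic(1)] by simp
    moreover have "eunit (?p ?ra) (?p ?ca) * eunit (?p (- ?cc)) (?p (- ?rc)) = (0 :: 'a inc)"
      using eunit_mult[OF le(1,4)] pidx_inj[OF ia(2) nc(2)] pos by simp
    moreover have "eunit (?p (- ?ca)) (?p (- ?ra)) * eunit (?p (- ?cc)) (?p (- ?rc)) =
        (if ?ra = ?cc then eunit (?p (- ?ca)) (?p (- ?rc)) else (0 :: 'a inc))"
      using eunit_mult[OF le(2,4)] pidx_inj[OF na(1) nc(2)] by simp
    ultimately show ?thesis by (simp only: root_inc_def left_diff_distrib right_diff_distrib) simp
  qed
  note eq = this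
  have at: "entry (eunit (?p x) (?p y) :: 'a inc) (?p ?rb) (?p ?cb) =
      (if x = ?rb \<and> y = ?cb then 1 else 0)" if "x \<in> idx \<Phi> n" "y \<in> idx \<Phi> n" for x y
    using pidx_inj[OF that(1) ib(1)] pidx_inj[OF that(2) ib(2)] le(5) by auto
  have entry_if: "entry (if c then x else (0 :: 'a inc)) r s = (if c then entry x r s else 0)" for c x r s
    by simp
  have "entry (root_inc \<Phi> n \<alpha> * root_inc \<Phi> n \<gamma> :: 'a inc) (?p ?rb) (?p ?cb) =
      (if ?ca = ?rc then (if ?ra = ?rb \<and> ?cc = ?cb then 1 else 0) else 0)
    - (if - ?ra = ?rc then (if - ?ca = ?rb \<and> ?cc = ?cb then 1 else 0) else 0)
    + (if ?ra = ?cc then (if - ?ca = ?rb \<and> - ?rc = ?cb then 1 else 0) else 0)"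
    unfolding eq entry_simps entry_if at[OF ia(1) ic(2)] at[OF na(2) ic(2)] at[OF na(2) nc(1)] ..
  then show ?thesis by (auto simp: bracket_term_def)
qed

text \<open>The nonzero structure constants of the Lie algebra are 1 and -1, hence nonzero in every
  field.\<close>

lemma bracket_term_diff:
  assumes "\<alpha> \<in> pos_roots \<Phi> n" "\<gamma> \<in> pos_roots \<Phi> n" "\<beta> \<in> pos_roots \<Phi> n"
  shows "bracket_term \<alpha> \<gamma> \<beta> - bracket_term \<gamma> \<alpha> \<beta> \<in> (if splits \<alpha> \<gamma> \<beta> \<or> splits \<gamma> \<alpha> \<beta> then {1, -1} else {0})"
  using assms by (cases \<alpha>; cases \<gamma>; cases \<beta>) (auto simp: bracket_term_def)

text \<open>The sum \<alpha> + \<gamma> is at most one root, so at most one term of the sum over D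
  survives and nothing can cancel.\<close>

lemma rook_functional_bracket_nonzero_iff:
  fixes \<xi> :: "root \<Rightarrow> 'a::field"
  assumes D: "D \<subseteq> pos_roots \<Phi> n" "\<forall>\<beta>\<in>D. \<xi> \<beta> \<noteq> 0"
    and \<alpha>: "\<alpha> \<in> pos_roots \<Phi> n" and \<gamma>: "\<gamma> \<in> pos_roots \<Phi> n"
  shows "rook_functional \<Phi> n D \<xi> (root_inc \<Phi> n \<alpha> * root_inc \<Phi> n \<gamma> - root_inc \<Phi> n \<gamma> * root_inc \<Phi> n \<alpha>) \<noteq> 0 \<longleftrightarrow>
    (\<exists>\<beta>\<in>D. splits \<alpha> \<gamma> \<beta> \<or> splits \<gamma> \<alpha> \<beta>)"
proof -
  let ?s = "\<lambda>\<beta>. splits \<alpha> \<gamma> \<beta> \<or> splits \<gamma> \<alpha> \<beta>"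
  let ?t = "\<lambda>\<beta>. \<xi> \<beta> * of_int (bracket_term \<alpha> \<gamma> \<beta> - bracket_term \<gamma> \<alpha> \<beta>)"
  have eq: "rook_functional \<Phi> n D \<xi> (root_inc \<Phi> n \<alpha> * root_inc \<Phi> n \<gamma> - root_inc \<Phi> n \<gamma> * root_inc \<Phi> n \<alpha>) = (\<Sum>\<beta>\<in>D. ?t \<beta>)"
    unfolding rook_functional_def using D(1) \<alpha> \<gamma> by (intro sum.cong) (auto simp: entry_root_inc_mult)
  have zero: "?t \<beta> = 0" if "\<beta> \<in> D" "\<not> ?s \<beta>" for \<beta>
    using bracket_term_diff[OF \<alpha> \<gamma>, of \<beta>] D(1) that by auto
  show ?thesis
  proof (cases "\<exists>\<beta>\<in>D. ?s \<beta>")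
    case False
    then have "(\<Sum>\<beta>\<in>D. ?t \<beta>) = 0" using zero by (intro sum.neutral) blast
    then show ?thesis using False eq by simp
  next
    case True
    then obtain \<beta> where \<beta>: "\<beta> \<in> D" "?s \<beta>" by blast
    have uniq: "\<beta>' = \<beta>" if "\<beta>' \<in> D" "?s \<beta>'" for \<beta>'
    proof -
      have "root_vec n \<beta>' = root_vec n \<beta>"
        using root_vec_add_iff_splits[OF \<alpha> \<gamma>] that \<beta> D(1) by (metis subsetD)
      then show ?thesis using inj_on_root_vec[of n \<Phi>] that(1) \<beta>(1) D(1) by (meson inj_onD subsetD)
    qed
    have fin: "finite D" using finite_subset[OF D(1)] by simp
    have "(\<Sum>\<beta>\<in>D. ?t \<beta>) = ?t \<beta> + (\<Sum>\<beta>\<in>D - {\<beta>}. ?t \<beta>)"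
      using sum.remove[OF fin \<beta>(1)] .
    also have "(\<Sum>\<beta>\<in>D - {\<beta>}. ?t \<beta>) = 0"
      using zero uniq by (intro sum.neutral) blast
    finally have "(\<Sum>\<beta>\<in>D. ?t \<beta>) = ?t \<beta>" by simp
    moreover have "bracket_term \<alpha> \<gamma> \<beta> - bracket_term \<gamma> \<alpha> \<beta> = 1 \<or> bracket_term \<alpha> \<gamma> \<beta> - bracket_term \<gamma> \<alpha> \<beta> = - 1"
      using bracket_term_diff[OF \<alpha> \<gamma>, of \<beta>] \<beta> D(1) by auto
    then have "?t \<beta> \<noteq> 0" using \<beta> D(2) by (auto simp del: of_int_diff)
    ultimately show ?thesis using True eq by simp
  qed
qed

lemma card_radical_rook_functional:
  fixes \<xi> :: "root \<Rightarrow> 'a::{field,finite}"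
  assumes two: "(2 :: 'a) \<noteq> 0"
    and D: "D \<subseteq> pos_roots \<Phi> n" "inj_on root_col D" "\<forall>\<beta>\<in>D. \<xi> \<beta> \<noteq> 0"
  shows "card (form_radical (mat_size \<Phi> n) (rook_functional \<Phi> n D \<xi>)) =
    CARD('a) ^ card (unmarked \<Phi> n (battleship \<Phi> n D))"
proof -
  let ?P = "pos_roots \<Phi> n" and ?f = "rook_functional \<Phi> n D \<xi>"
  define M where "M \<alpha> \<gamma> = ?f (root_inc \<Phi> n \<alpha> * root_inc \<Phi> n \<gamma> - root_inc \<Phi> n \<gamma> * root_inc \<Phi> n \<alpha>)" for \<alpha> \<gamma>
  have left: "?f (comb \<Phi> n c * z - z * comb \<Phi> n c) =
      (\<Sum>\<alpha>\<in>?P. c \<alpha> * ?f (root_inc \<Phi> n \<alpha> * z - z * root_inc \<Phi> n \<alpha>))" for c z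
  proof -
    have "comb \<Phi> n c * z - z * comb \<Phi> n c = (\<Sum>\<alpha>\<in>?P. scal (c \<alpha>) * (root_inc \<Phi> n \<alpha> * z - z * root_inc \<Phi> n \<alpha>))"
      unfolding comb_def sum_distrib_left sum_distrib_right sum_subtractf[symmetric]
      by (intro sum.cong refl) (simp add: right_diff_distrib scal_left_commute mult.assoc)
    then show ?thesis by (simp add: rook_functional_linear)
  qed
  have right: "?f (z * comb \<Phi> n c - comb \<Phi> n c * z) =
      (\<Sum>\<alpha>\<in>?P. c \<alpha> * ?f (z * root_inc \<Phi> n \<alpha> - root_inc \<Phi> n \<alpha> * z))" for c z
  proof -
    have "z * comb \<Phi> n c - comb \<Phi> n c * z = (\<Sum>\<alpha>\<in>?P. scal (c \<alpha>) * (z * root_inc \<Phi> n \<alpha> - root_inc \<Phi> n \<alpha> * z))"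
      unfolding comb_def sum_distrib_left sum_distrib_right sum_subtractf[symmetric]
      by (intro sum.cong refl) (simp add: right_diff_distrib scal_left_commute mult.assoc)
    then show ?thesis by (simp add: rook_functional_linear)
  qed
  note bij = bij_betw_comb[OF two, of \<Phi> n]
  have iff: "comb \<Phi> n c \<in> form_radical (mat_size \<Phi> n) ?f \<longleftrightarrow> (\<forall>\<gamma>\<in>?P. (\<Sum>\<alpha>\<in>?P. c \<alpha> * M \<alpha> \<gamma>) = 0)" for c
  proof
    assume c: "comb \<Phi> n c \<in> form_radical (mat_size \<Phi> n) ?f"
    show "\<forall>\<gamma>\<in>?P. (\<Sum>\<alpha>\<in>?P. c \<alpha> * M \<alpha> \<gamma>) = 0"
    proof
      fix \<gamma> assume "\<gamma> \<in> ?P"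
      then show "(\<Sum>\<alpha>\<in>?P. c \<alpha> * M \<alpha> \<gamma>) = 0"
        using c root_inc_skews[of \<gamma> \<Phi> n, where 'a = 'a] left[of c "root_inc \<Phi> n \<gamma>"] by (simp add: form_radical_def M_def)
    qed
  next
    assume c: "\<forall>\<gamma>\<in>?P. (\<Sum>\<alpha>\<in>?P. c \<alpha> * M \<alpha> \<gamma>) = 0"
    have "?f (comb \<Phi> n c * z - z * comb \<Phi> n c) = 0" if "z \<in> skews (mat_size \<Phi> n)" for z
    proof -
      have "z \<in> comb \<Phi> n ` (?P \<rightarrow>\<^sub>E UNIV)" using that bij by (simp add: bij_betw_def)
      then obtain d where "z = comb \<Phi> n d" by (rule imageE)
      moreover have "?f (comb \<Phi> n c * root_inc \<Phi> n \<gamma> - root_inc \<Phi> n \<gamma> * comb \<Phi> n c) = 0" if "\<gamma> \<in> ?P" for \<gamma>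
        using c that left[of c "root_inc \<Phi> n \<gamma>"] by (simp add: M_def)
      ultimately show ?thesis using right[of "comb \<Phi> n c" d] by simp
    qed
    then show "comb \<Phi> n c \<in> form_radical (mat_size \<Phi> n) ?f" by (simp add: form_radical_def comb_skews)
  qed
  have "comb \<Phi> n ` left_kernel ?P M = form_radical (mat_size \<Phi> n) ?f"
  proof (intro equalityI subsetI)
    fix x assume "x \<in> comb \<Phi> n ` left_kernel ?P M"
    then show "x \<in> form_radical (mat_size \<Phi> n) ?f" using iff by (auto simp: left_kernel_def)
  next
    fix x assume x: "x \<in> form_radical (mat_size \<Phi> n) ?f"
    then have "x \<in> comb \<Phi> n ` (?P \<rightarrow>\<^sub>E UNIV)" using bij by (simp add: form_radical_def bij_betw_def)
    then obtain c where c: "x = comb \<Phi> n c" "c \<in> ?P \<rightarrow>\<^sub>E UNIV" by (rule imageE)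
    then have "c \<in> left_kernel ?P M" using x iff by (simp add: left_kernel_def)
    then show "x \<in> comb \<Phi> n ` left_kernel ?P M" using c by blast
  qed
  moreover have "inj_on (comb \<Phi> n) (left_kernel ?P M)"
    using bij by (auto simp: bij_betw_def left_kernel_def intro: inj_on_subset)
  ultimately have "card (form_radical (mat_size \<Phi> n) ?f) = card (left_kernel ?P M)"
    by (metis card_image)
  also have "\<dots> = CARD('a) ^ card (unmarked \<Phi> n (battleship \<Phi> n D))"
    using rook_functional_bracket_nonzero_iff[OF D(1,3)] by (intro card_left_kernel_battleship D) (simp add: M_def)
  finally show ?thesis .
qed

section \<open>Functionals, the coadjoint orbit and its dimension\<close>

lemma root_mat_in_lie_u:
  assumes "\<alpha> \<in> pos_roots \<Phi> n"
  shows "root_mat \<Phi> n \<alpha> \<in> lie_u \<Phi> n"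
proof -
  let ?c = "\<lambda>\<gamma>. if \<gamma> = \<alpha> then 1 else 0 :: 'a"
  have "comb \<Phi> n ?c = (\<Sum>\<gamma>\<in>pos_roots \<Phi> n. if \<gamma> = \<alpha> then root_inc \<Phi> n \<gamma> else 0)"
    unfolding comb_def by (intro sum.cong) (auto simp: scal_hom)
  then have "comb \<Phi> n ?c = root_inc \<Phi> n \<alpha>" using assms by simp
  then have "root_mat \<Phi> n \<alpha> = root_comb \<Phi> n ?c"
    using assms by (simp add: root_comb_eq_block root_mat_eq_block)
  then show ?thesis unfolding lie_u_def by blast
qed

text \<open>Elements of the dual are additive only on the Lie algebra, so every partial sum of the
  induction must be shown to lie there; its missing coefficients are filled up with zeros.\<close>

lemma dual_u_root_comb:
  fixes f :: "'a::field mat \<Rightarrow> 'a"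
  assumes f: "f \<in> dual_u \<Phi> n"
  shows "f (root_comb \<Phi> n c) = (\<Sum>\<alpha>\<in>pos_roots \<Phi> n. c \<alpha> * f (root_mat \<Phi> n \<alpha>))"
proof -
  let ?m = "mat_size \<Phi> n"
  let ?S = "\<lambda>A. block ?m (\<Sum>\<alpha>\<in>A. scal (c \<alpha>) * root_inc \<Phi> n \<alpha>)"
  have in_lie: "?S A \<in> lie_u \<Phi> n" if A: "A \<subseteq> pos_roots \<Phi> n" for A
  proof -
    have "(\<Sum>\<alpha>\<in>A. scal (c \<alpha>) * root_inc \<Phi> n \<alpha>) = comb \<Phi> n (\<lambda>\<alpha>. if \<alpha> \<in> A then c \<alpha> else 0)"
      unfolding comb_def using A by (intro sum.mono_neutral_cong_left) (auto simp: scal_hom)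
    then have "?S A = root_comb \<Phi> n (\<lambda>\<alpha>. if \<alpha> \<in> A then c \<alpha> else 0)" by (simp add: root_comb_eq_block)
    then show ?thesis unfolding lie_u_def by blast
  qed
  have "f (?S A) = (\<Sum>\<alpha>\<in>A. c \<alpha> * f (root_mat \<Phi> n \<alpha>))" if "A \<subseteq> pos_roots \<Phi> n" for A
    using finite_subset[OF that finite_pos_roots] that
  proof (induction A rule: finite_induct)
    case empty
    \<comment> \<open>Homogeneity with the scalar 0 yields the value 0 at the zero matrix.\<close>
    have z: "?S {} = 0 \<cdot>\<^sub>m ?S {}" by (rule eq_matI) auto
    have "f (0 \<cdot>\<^sub>m ?S {}) = 0 * f (?S {})" using f in_lie[of "{}"] unfolding dual_u_def by blast
    then show ?case using z by simp
  next
    case (insert \<alpha> A)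
    have \<alpha>: "\<alpha> \<in> pos_roots \<Phi> n" and A: "A \<subseteq> pos_roots \<Phi> n" using insert.prems by auto
    have root: "root_mat \<Phi> n \<alpha> \<in> lie_u \<Phi> n" by (rule root_mat_in_lie_u[OF \<alpha>])
    have single: "c \<alpha> \<cdot>\<^sub>m root_mat \<Phi> n \<alpha> = ?S {\<alpha>}"
      using \<alpha> by (simp add: block_scal root_mat_eq_block)
    have "?S (insert \<alpha> A) = c \<alpha> \<cdot>\<^sub>m root_mat \<Phi> n \<alpha> + ?S A"
      using insert.hyps \<alpha> by (simp add: block_add block_scal root_mat_eq_block)
    moreover have "f (c \<alpha> \<cdot>\<^sub>m root_mat \<Phi> n \<alpha> + ?S A) = f (c \<alpha> \<cdot>\<^sub>m root_mat \<Phi> n \<alpha>) + f (?S A)"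
      using f in_lie[OF A] in_lie[of "{\<alpha>}"] \<alpha> unfolding single dual_u_def by blast
    moreover have "f (c \<alpha> \<cdot>\<^sub>m root_mat \<Phi> n \<alpha>) = c \<alpha> * f (root_mat \<Phi> n \<alpha>)"
      using f root unfolding dual_u_def by blast
    ultimately show ?case using insert.IH[OF A] insert.hyps by simp
  qed
  from this[OF subset_refl] show ?thesis by (simp add: root_comb_eq_block comb_def)
qed

lemma root_pos_of_less:
  assumes "\<alpha> \<in> pos_roots \<Phi> n"
  shows "pos_of \<Phi> n (root_row \<alpha>) < mat_size \<Phi> n" "pos_of \<Phi> n (int (root_col \<alpha>)) < mat_size \<Phi> n"
  using root_idx[OF assms] pidx_bounds by blast+

lemma lie_u_carrier: "x \<in> lie_u \<Phi> n \<Longrightarrow> x \<in> carrier_mat (mat_size \<Phi> n) (mat_size \<Phi> n)"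
  by (auto simp: lie_u_def root_comb_eq_block)

lemma lie_u_add: "x \<in> lie_u \<Phi> n \<Longrightarrow> y \<in> lie_u \<Phi> n \<Longrightarrow> x + y \<in> lie_u \<Phi> n"
proof -
  assume "x \<in> lie_u \<Phi> n" "y \<in> lie_u \<Phi> n"
  then obtain c d where "x = root_comb \<Phi> n c" "y = root_comb \<Phi> n d" by (auto simp: lie_u_def)
  then have "x + y = root_comb \<Phi> n (\<lambda>\<alpha>. c \<alpha> + d \<alpha>)"
    by (simp add: root_comb_eq_block block_add[symmetric] comb_def scal_hom distrib_right sum.distrib)
  then show ?thesis by (auto simp: lie_u_def)
qed

lemma lie_u_smult: "x \<in> lie_u \<Phi> n \<Longrightarrow> a \<cdot>\<^sub>m x \<in> lie_u \<Phi> n"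
proof -
  assume "x \<in> lie_u \<Phi> n"
  then obtain c where "x = root_comb \<Phi> n c" by (auto simp: lie_u_def)
  then have "a \<cdot>\<^sub>m x = root_comb \<Phi> n (\<lambda>\<alpha>. a * c \<alpha>)"
    by (simp add: root_comb_eq_block block_scal[symmetric] comb_def scal_hom sum_distrib_left mult.assoc)
  then show ?thesis by (auto simp: lie_u_def)
qed

text \<open>At the position of \<beta> the matrix of \<beta> has entry 1 and all other basis
  matrices have entry 0. Reading off this entry is thus the functional sought, and linearity makes
  it unique.\<close>

lemma dual_basis_eq:
  fixes x :: "'a::field mat"
  assumes \<beta>: "\<beta> \<in> pos_roots \<Phi> n" and x: "x \<in> lie_u \<Phi> n"
  shows "dual_basis \<Phi> n \<beta> x = x $$ (pos_of \<Phi> n (root_row \<beta>), pos_of \<Phi> n (int (root_col \<beta>)))"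
proof -
  let ?at = "(pos_of \<Phi> n (root_row \<beta>), pos_of \<Phi> n (int (root_col \<beta>)))"
  let ?m = "mat_size \<Phi> n"
  define f where "f = (\<lambda>x\<in>lie_u \<Phi> n. x $$ ?at :: 'a)"
  note b = root_pos_of_less[OF \<beta>]
  have "f (x + y) = f x + f y" if "x \<in> lie_u \<Phi> n" "y \<in> lie_u \<Phi> n" for x y
    using that b lie_u_carrier[OF that(1)] lie_u_carrier[OF that(2)] lie_u_add[OF that]
    by (simp add: f_def)
  moreover have "f (c \<cdot>\<^sub>m x) = c * f x" if "x \<in> lie_u \<Phi> n" for c x
    using that b lie_u_carrier[OF that] lie_u_smult[OF that, of c] by (simp add: f_def)
  ultimately have f: "f \<in> dual_u \<Phi> n" by (simp add: dual_u_def) (simp add: f_def)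
  have basis: "f (root_mat \<Phi> n \<gamma>) = (if \<gamma> = \<beta> then 1 else 0)" if "\<gamma> \<in> pos_roots \<Phi> n" for \<gamma>
    using entry_root_inc[OF \<beta> that, where 'a = 'a] root_mat_in_lie_u[OF that, where 'a = 'a] b that
    by (simp add: f_def root_mat_eq_block)
  have "dual_basis \<Phi> n \<beta> = f"
    unfolding dual_basis_def
  proof (rule the_equality)
    show "f \<in> dual_u \<Phi> n \<and> (\<forall>\<gamma>\<in>pos_roots \<Phi> n. f (root_mat \<Phi> n \<gamma>) = (if \<gamma> = \<beta> then 1 else 0))"
      using f basis by blast
    fix g :: "'a mat \<Rightarrow> 'a"
    assume g: "g \<in> dual_u \<Phi> n \<and> (\<forall>\<gamma>\<in>pos_roots \<Phi> n. g (root_mat \<Phi> n \<gamma>) = (if \<gamma> = \<beta> then 1 else 0))"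
    show "g = f"
    proof (rule extensionalityI)
      show "g \<in> extensional (lie_u \<Phi> n)" "f \<in> extensional (lie_u \<Phi> n)"
        using f g by (auto simp: dual_u_def)
      fix x :: "'a mat" assume "x \<in> lie_u \<Phi> n"
      then obtain c where "x = root_comb \<Phi> n c" by (auto simp: lie_u_def)
      then show "g x = f x"
        using dual_u_root_comb[OF f, of c] dual_u_root_comb[of g \<Phi> n c] g basis by simp
    qed
  qed
  then show ?thesis using x by (simp add: f_def)
qed

lemma rook_form_block:
  assumes "(2 :: 'a::field) \<noteq> 0" "D \<subseteq> pos_roots \<Phi> n" "x \<in> skews (mat_size \<Phi> n)"
  shows "rook_form \<Phi> n D \<xi> (block (mat_size \<Phi> n) (x :: 'a inc)) = rook_functional \<Phi> n D \<xi> x"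
proof -
  have "block (mat_size \<Phi> n) x \<in> lie_u \<Phi> n" using assms by (simp add: lie_u_eq_block)
  then have "rook_form \<Phi> n D \<xi> (block (mat_size \<Phi> n) x) =
      (\<Sum>\<beta>\<in>D. \<xi> \<beta> * dual_basis \<Phi> n \<beta> (block (mat_size \<Phi> n) x))"
    by (simp add: rook_form_def)
  also have "\<dots> = rook_functional \<Phi> n D \<xi> x"
    unfolding rook_functional_def using \<open>block _ x \<in> _\<close> assms(2)
    by (intro sum.cong refl) (auto simp: dual_basis_eq root_pos_of_less subset_iff)
  finally show ?thesis .
qed

lemma card_image_eq_kernel:
  assumes "\<And>a b. a \<in> A \<Longrightarrow> b \<in> A \<Longrightarrow> f a = f b \<longleftrightarrow> g a = g b"
  shows "card (f ` A) = card (g ` A)"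
proof (rule bij_betw_same_card)
  show "bij_betw (\<lambda>y. g (inv_into A f y)) (f ` A) (g ` A)"
  proof (rule bij_betw_imageI)
    show "inj_on (\<lambda>y. g (inv_into A f y)) (f ` A)"
      using assms by (intro inj_onI) (metis f_inv_into_f inv_into_into)
    have "g (inv_into A f (f a)) = g a" if "a \<in> A" for a
      using assms that by (metis f_inv_into_f imageI inv_into_into)
    then show "(\<lambda>y. g (inv_into A f y)) ` f ` A = g ` A" by (simp add: image_image)
  qed
qed

text \<open>The two orbits consist of functionals on different sets, matrices and elements of the
  incidence algebra. They have equal size because their orbit maps identify the same pairs of group
  elements.\<close>

lemma card_rook_orbit:
  fixes \<xi> :: "root \<Rightarrow> 'a::field"
  assumes fact: "\<And>i. i < mat_size \<Phi> n \<Longrightarrow> of_nat (fact i) \<noteq> (0 :: 'a)" and m: "3 \<le> mat_size \<Phi> n"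
    and fin: "finite (skews (mat_size \<Phi> n) :: 'a inc set)" and D: "D \<subseteq> pos_roots \<Phi> n"
  shows "card (rook_orbit \<Phi> n D \<xi>) = card ((\<lambda>g. \<lambda>y\<in>skews (mat_size \<Phi> n).
    rook_functional \<Phi> n D \<xi> (star (int (mat_size \<Phi> n) - 1) g * y * g)) ` orth_group (mat_size \<Phi> n))"
proof -
  let ?m = "mat_size \<Phi> n"
  let ?s = "star (int ?m - 1)"
  let ?act = "\<lambda>g. \<lambda>y\<in>skews ?m. rook_functional \<Phi> n D \<xi> (?s g * y * g)"
  let ?co = "\<lambda>g. coadjoint \<Phi> n (block ?m g) (rook_form \<Phi> n D \<xi>)"
  have two: "(2 :: 'a) \<noteq> 0" using fact[of 2] m by (simp add: fact_2)
  have "group_U \<Phi> n = trunc_exp ?m ` block ?m ` (skews ?m :: 'a inc set)"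
    by (simp add: group_U_def lie_u_eq_block[OF two])
  also have "\<dots> = block ?m ` expm ?m ` skews ?m"
    by (simp add: image_image block_expm)
  finally have U: "group_U \<Phi> n = block ?m ` (orth_group ?m :: 'a inc set)"
    using expm_image_skews[OF fact m fin] by simp
  have co: "?co g (block ?m y) = rook_functional \<Phi> n D \<xi> (?s g * y * g)"
    if g: "g \<in> orth_group ?m" and y: "y \<in> skews ?m" for g y :: "'a inc"
  proof -
    have "mat_inverse (block ?m g) = Some (block ?m (?s g))"
      using g by (intro mat_inverse_eqI[of _ ?m]) (simp_all add: block_mult[symmetric] orth_group_def block_one)
    then have "?co g (block ?m y) = rook_form \<Phi> n D \<xi> (block ?m (?s g * y * g))"
      using y by (simp add: coadjoint_def lie_u_eq_block[OF two] block_mult)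
    also have "\<dots> = rook_functional \<Phi> n D \<xi> (?s g * y * g)"
      using g y by (intro rook_form_block two D skews_conj) (auto simp: orth_group_def)
    finally show ?thesis .
  qed
  have "?co g = ?co h \<longleftrightarrow> ?act g = ?act h" if "g \<in> orth_group ?m" "h \<in> orth_group ?m" for g h
  proof -
    have "?co g = ?co h \<longleftrightarrow> (\<forall>x\<in>lie_u \<Phi> n. ?co g x = ?co h x)"
      by (auto simp: coadjoint_def fun_eq_iff restrict_def)
    also have "\<dots> \<longleftrightarrow> (\<forall>y\<in>skews ?m. ?act g y = ?act h y)"
      using co that by (simp add: lie_u_eq_block[OF two])
    also have "\<dots> \<longleftrightarrow> ?act g = ?act h"
      by (auto simp: fun_eq_iff restrict_def)
    finally show ?thesis .
  qed
  then have "card (?co ` orth_group ?m) = card (?act ` orth_group ?m)"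
    by (rule card_image_eq_kernel)
  then show ?thesis by (simp add: rook_orbit_def coadjoint_orbit_def U image_image)
qed

section \<open>The characteristic, the degenerate sizes and the final count\<close>

lemma of_nat_fact_nonzero:
  assumes "i < CHAR('a::{field,finite})"
  shows "of_nat (fact i) \<noteq> (0 :: 'a)"
proof -
  have "prime CHAR('a)" by (intro prime_CHAR_semidom finite_imp_CHAR_pos) simp
  then show ?thesis using assms by (simp add: of_nat_eq_0_iff_char_dvd prime_dvd_fact_iff)
qed

lemma orbit_dim_eqI:
  fixes \<Omega> :: "('a::{field,finite} mat \<Rightarrow> 'a) set"
  assumes "card \<Omega> = CARD('a) ^ d"
  shows "orbit_dim \<Omega> = d"
proof -
  have "card {0, 1 :: 'a} \<le> CARD('a)" by (rule card_mono) auto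
  then have "1 < CARD('a)" by simp
  then show ?thesis unfolding orbit_dim_def assms by (intro the_equality) auto
qed

text \<open>These are the types D_0, B_0 and D_1. They are set apart because the bound on the
  characteristic does not make 2 invertible for them.\<close>

lemma pos_roots_empty:
  assumes "mat_size \<Phi> n < 3"
  shows "pos_roots \<Phi> n = {}"
proof -
  have "\<alpha> \<notin> pos_roots \<Phi> n" for \<alpha>
    using assms by (cases \<alpha>; cases \<Phi>) (auto simp: mat_size_def)
  then show ?thesis by blast
qed

lemma rook_orbit_no_roots:
  assumes "pos_roots \<Phi> n = {}"
  shows "card (rook_orbit \<Phi> n D \<xi>) = 1"
proof -
  have "\<exists>x. lie_u \<Phi> n = {x :: 'a mat}"
    by (simp add: lie_u_def root_comb_def assms image_constant_conv)
  then show ?thesis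
    by (auto simp: rook_orbit_def coadjoint_orbit_def group_U_def)
qed

theorem corollary3p8:
  fixes \<Phi> :: root_type and n :: nat and D :: "root set"
    and \<xi> :: "root \<Rightarrow> 'a::{field,finite}"
  assumes "CHAR('a) \<ge> mat_size \<Phi> n"
    and "orthogonal_rook_placement \<Phi> n D"
    and "\<forall>\<beta>\<in>D. \<xi> \<beta> \<noteq> 0"
  shows "orbit_dim (rook_orbit \<Phi> n D \<xi>) =
    card {\<alpha> \<in> pos_roots \<Phi> n. battleship \<Phi> n D \<alpha> \<in> {Plus_mark, Minus_mark}}"
proof (rule orbit_dim_eqI)
  let ?m = "mat_size \<Phi> n" and ?P = "pos_roots \<Phi> n"
  let ?R = "{\<alpha> \<in> ?P. marked (battleship \<Phi> n D \<alpha>)}" and ?U = "unmarked \<Phi> n (battleship \<Phi> n D)"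
  have D: "D \<subseteq> ?P" and cols: "\<And>j. card (D \<inter> roots_in_col \<Phi> n j) \<le> 1"
    using assms(2) by (auto simp: orthogonal_rook_placement_def)
  show "card (rook_orbit \<Phi> n D \<xi>) = CARD('a) ^ card ?R"
  proof (cases "?m < 3")
    case True
    from pos_roots_empty[OF this] show ?thesis by (simp add: rook_orbit_no_roots)
  next
    case False
    then have m: "3 \<le> ?m" by simp
    have fact: "of_nat (fact i) \<noteq> (0 :: 'a)" if "i < ?m" for i
      using that assms(1) by (intro of_nat_fact_nonzero) simp
    have two: "(2 :: 'a) \<noteq> 0" using fact[of 2] m by (simp add: fact_2)
    have finP: "finite (?P \<rightarrow>\<^sub>E (UNIV :: 'a set))" by (simp add: finite_PiE)
    note bij = bij_betw_comb[OF two, of \<Phi> n]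
    have fin: "finite (skews ?m :: 'a inc set)" using bij finP by (simp add: bij_betw_finite)
    have card_skews: "card (skews ?m :: 'a inc set) = CARD('a) ^ card ?P"
      using bij_betw_same_card[OF bij] by (simp add: card_PiE)
    have inj: "inj_on root_col D"
    proof (rule inj_onI)
      fix \<alpha> \<beta> assume "\<alpha> \<in> D" "\<beta> \<in> D" "root_col \<alpha> = root_col \<beta>"
      then have "{\<alpha>, \<beta>} \<subseteq> D \<inter> roots_in_col \<Phi> n (root_col \<beta>)"
        using D by (auto simp: roots_in_col_def)
      then have "card {\<alpha>, \<beta>} \<le> 1"
        using cols[of "root_col \<beta>"] card_mono[of "D \<inter> roots_in_col \<Phi> n (root_col \<beta>)" "{\<alpha>, \<beta>}"]
          finite_subset[OF D finite_pos_roots] by simp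
      then show "\<alpha> = \<beta>" by (cases "\<alpha> = \<beta>") auto
    qed
    have "card (rook_orbit \<Phi> n D \<xi>) * card (form_radical ?m (rook_functional \<Phi> n D \<xi>)) = card (skews ?m :: 'a inc set)"
      using card_orbit_times_card_radical[of "rook_functional \<Phi> n D \<xi>" ?m, OF rook_functional_linear(1) two _ fin] m
      by (simp add: card_rook_orbit[OF fact m fin D])
    then have "card (rook_orbit \<Phi> n D \<xi>) * CARD('a) ^ card ?U = CARD('a) ^ card ?P"
      unfolding card_radical_rook_functional[OF two D inj assms(3)] card_skews .
    moreover have "card ?P = card ?R + card ?U"
    proof -
      have "?P = ?R \<union> ?U" "?R \<inter> ?U = {}" by (auto simp: unmarked_def)
      moreover have "finite ?R" "finite ?U" by (auto simp: unmarked_def)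
      ultimately show ?thesis by (metis card_Un_disjoint)
    qed
    ultimately show ?thesis by (simp add: power_add)
  qed
qed

end
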